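(* Let $s\in(0,1)$, $N>2s$, $2^*=\frac{2N}{N-2s}$, $p=2^*-1=\frac{N+2s}{N-2s}$ and $q>p$. Then the problem $$(-\Delta)^s u=u^p-u^q\ \text{ in }\mathbb{R}^N,\quad u\in\dot H^s(\mathbb{R}^N)\cap L^{q+1}(\mathbb{R}^N),\quad u>0\ \text{ in }\mathbb{R}^N$$ does not have any (weak) solution.
   Context: $c_{N,s}=\frac{2^{2s}s\,\Gamma(\frac N2+s)}{\pi^{N/2}\Gamma(1-s)}$. Set $\|u\|^2_{\dot H^s(\mathbb{R}^N)}=\frac{c_{N,s}}{2}\int_{\mathbb{R}^N}\int_{\mathbb{R}^N}\frac{|u(x)-u(y)|^2}{|x-y|^{N+2s}}\,dx\,dy$; $\dot H^s(\mathbb{R}^N)$ is the completion of $C_0^\infty(\mathbb{R}^N)$ with respect to $\|u\|_{\dot H^s(\mathbb{R}^N)}+|u|_{L^{2^*}(\mathbb{R}^N)}$. A weak solution of the problem is a function $u\in\dot H^s(\mathbb{R}^N)\cap L^{q+1}(\mathbb{R}^N)$ with $u>0$ in $\mathbb{R}^N$ such that for every $\varphi\in\dot H^s(\mathbb{R}^N)$ $$\frac{c_{N,s}}{2}\int_{\mathbb{R}^N}\int_{\mathbb{R}^N}\frac{(u(x)-u(y))(\varphi(x)-\varphi(y))}{|x-y|^{N+2s}}\,dx\,dy=\int_{\mathbb{R}^N}u^p\varphi\,dx-\int_{\mathbb{R}^N}u^q\varphi\,dx .$$ *)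

theory Defs
  imports "HOL-Analysis.Analysis"
begin

text \<open>
  Elements of the function spaces below are represented by Borel measurable functions on
  \<^typ>\<open>real ^ 'n\<close>, where \<open>N = CARD('n)\<close>; every almost-everywhere class has such a representative.
\<close>

definition crit_exp :: "nat \<Rightarrow> real \<Rightarrow> real" where
  "crit_exp N s = 2 * real N / (real N - 2 * s)"

definition frac_const :: "nat \<Rightarrow> real \<Rightarrow> real" where
  "frac_const N s =
     2 powr (2 * s) * s * Gamma (real N / 2 + s) / (pi powr (real N / 2) * Gamma (1 - s))"

text \<open>On the (null) diagonal \<open>x = y\<close> the integrand takes the value \<open>0\<close>, by the convention \<open>a / 0 = 0\<close>.\<close>

definition gagliardo_integrand ::
  "real \<Rightarrow> (real ^ 'n \<Rightarrow> real) \<Rightarrow> (real ^ 'n \<Rightarrow> real) \<Rightarrow> (real ^ 'n) \<times> (real ^ 'n) \<Rightarrow> real" where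
  "gagliardo_integrand s u v =
     (\<lambda>(x, y). (u x - u y) * (v x - v y) / norm (x - y) powr (real CARD('n) + 2 * s))"

definition gagliardo_form ::
  "real \<Rightarrow> (real ^ 'n \<Rightarrow> real) \<Rightarrow> (real ^ 'n \<Rightarrow> real) \<Rightarrow> real" where
  "gagliardo_form s u v =
     frac_const CARD('n) s / 2 *
       (\<integral>z. gagliardo_integrand s u v z \<partial>((lborel :: (real ^ 'n) measure) \<Otimes>\<^sub>M lborel))"

definition finite_energy :: "real \<Rightarrow> (real ^ 'n \<Rightarrow> real) \<Rightarrow> bool" where
  "finite_energy s u \<longleftrightarrow>
     integrable ((lborel :: (real ^ 'n) measure) \<Otimes>\<^sub>M lborel) (gagliardo_integrand s u u)"

definition Hdot_norm :: "real \<Rightarrow> (real ^ 'n \<Rightarrow> real) \<Rightarrow> real" where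
  "Hdot_norm s u = sqrt (gagliardo_form s u u)"

definition Lp_space :: "real \<Rightarrow> (real ^ 'n \<Rightarrow> real) set" where
  "Lp_space r = {u \<in> borel_measurable lborel. integrable lborel (\<lambda>x. \<bar>u x\<bar> powr r)}"

definition Lp_norm :: "real \<Rightarrow> (real ^ 'n \<Rightarrow> real) \<Rightarrow> real" where
  "Lp_norm r u = (\<integral>x. \<bar>u x\<bar> powr r \<partial>lborel) powr (1 / r)"

primrec Ck_fun :: "nat \<Rightarrow> (real ^ 'n \<Rightarrow> real) \<Rightarrow> bool" where
  "Ck_fun 0 f \<longleftrightarrow> continuous_on UNIV f"
| "Ck_fun (Suc k) f \<longleftrightarrow>
     f differentiable_on UNIV \<and>
     (\<forall>i. Ck_fun k (\<lambda>x. frechet_derivative f (at x) (axis i 1)))"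

definition test_functions :: "(real ^ 'n \<Rightarrow> real) set" where
  "test_functions = {f. (\<forall>k. Ck_fun k f) \<and> compact (closure {x. f x \<noteq> 0})}"

text \<open>
  Since the norm \<open>\<parallel>u\<parallel> + |u|\<close> contains the Lebesgue norm of exponent \<open>2\<^sup>*\<close>, a Cauchy sequence of test
  functions has an \<open>L\<close>-limit \<open>u\<close>, and by Fatou's lemma \<open>u\<close> has finite energy and is also the limit
  in the full norm; moreover \<open>u\<close> determines the sequence up to equivalence. So the completion is
  the closure of the test functions among the functions for which this norm is finite. The two
  finiteness conditions ensure that the real-valued integrals inside the norms are genuine.
\<close>

definition Hdot :: "real \<Rightarrow> (real ^ 'n \<Rightarrow> real) set" where
  "Hdot s =
     {u \<in> Lp_space (crit_exp CARD('n) s). finite_energy s u \<and>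
        (\<exists>\<phi>. (\<forall>k. \<phi> k \<in> test_functions) \<and>
             (\<lambda>k. Hdot_norm s (\<lambda>x. u x - \<phi> k x)
                 + Lp_norm (crit_exp CARD('n) s) (\<lambda>x. u x - \<phi> k x)) \<longlonglongrightarrow> 0)}"

text \<open>
  For \<open>u, \<phi> \<in> Hdot s\<close> and \<open>p = 2\<^sup>* - 1\<close> the double integral and the integral of \<open>u\<^sup>p \<phi>\<close> converge
  absolutely, by Cauchy-Schwarz and Hoelder. Convergence of the integral of \<open>u\<^sup>q \<phi>\<close>
  is part of what the identity asserts, and is stated explicitly because a divergent Bochner
  integral has the value \<open>0\<close>. Positivity is understood almost everywhere, as \<open>u\<close>
  represents a class.
\<close>

definition weak_solution :: "real \<Rightarrow> real \<Rightarrow> real \<Rightarrow> (real ^ 'n \<Rightarrow> real) \<Rightarrow> bool" where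
  "weak_solution s p q u \<longleftrightarrow>
     u \<in> Hdot s \<inter> Lp_space (q + 1) \<and>
     (AE x in lborel. u x > 0) \<and>
     (\<forall>\<phi> \<in> Hdot s.
        integrable lborel (\<lambda>x. u x powr q * \<phi> x) \<and>
        gagliardo_form s u \<phi> =
          (\<integral>x. u x powr p * \<phi> x \<partial>lborel) - (\<integral>x. u x powr q * \<phi> x \<partial>lborel))"

end

theory Submission
  imports Defs
begin

text \<open>
  The Pohozaev argument is run with the genuine dilations \<open>u(l \<cdot>)\<close>, \<open>l \<rightarrow> 1\<close>, as test functions, so that
  no pointwise regularity of \<open>u\<close> is needed. With \<open>w = u(l \<cdot>) - u\<close> and \<open>f(x) = x\<^sup>p - x\<^sup>q\<close>, the scaling of
  the form and of the two integrals turns the second order Taylor estimate of the primitive of \<open>f\<close> into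
  \<open>c\<^sub>1 (1 - l) + c\<^sub>2 \<parallel>w\<parallel>\<^sup>2 \<le> p/2 \<integral> W w\<^sup>2\<close>, where \<open>c\<^sub>1 > 0\<close> because \<open>q > p\<close> and \<open>W\<close> only involves the
  truncation of \<open>u\<close> at \<open>1\<close>, because \<open>f\<close> is decreasing above \<open>1\<close>. The fractional Sobolev inequality
  absorbs the part of the right-hand side outside a large ball \<open>B\<close>, so that, with \<open>l = exp (-t)\<close>,
  \<open>E(t) = \<integral>\<^sub>B w\<^sup>2\<close> controls both \<open>t\<close> and \<open>\<parallel>w\<parallel>\<^sup>2\<close>. On the other hand, applying the dilation once more,
  \<open>\<parallel>w(l \<cdot>) - w\<parallel>\<close> in \<open>L\<^sup>2(B)\<close> is at most \<open>C t\<^sup>s \<parallel>w\<parallel>\<close>, hence at most \<open>C' t\<^sup>s sqrt (E(t))\<close>, and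
  \<open>2 w = (u(l\<^sup>2 \<cdot>) - u) - (w(l \<cdot>) - w)\<close> shows that \<open>E(t)\<close> is essentially at most \<open>E(2t) / 4\<close>. So
  \<open>E(t) = o(t)\<close> along \<open>t = t\<^sub>0 / 2\<^sup>n\<close>, a contradiction.
\<close>

section \<open>Dilations\<close>

lemma nn_integral_dilation:
  fixes f :: "'a::euclidean_space \<Rightarrow> ennreal"
  assumes [measurable]: "f \<in> borel_measurable borel" and c: "c \<noteq> 0"
  shows "(\<integral>\<^sup>+x. f x \<partial>lborel) = ennreal (\<bar>c\<bar> ^ DIM('a)) * (\<integral>\<^sup>+x. f (c *\<^sub>R x) \<partial>lborel)"
  by (subst lborel_affine[OF c, of 0])
     (simp add: nn_integral_density nn_integral_distr nn_integral_cmult)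

lemma integrable_dilation:
  fixes f :: "'a::euclidean_space \<Rightarrow> real"
  assumes f: "integrable lborel f" and c: "c \<noteq> 0"
  shows "integrable lborel (\<lambda>x. f (c *\<^sub>R x))"
  using f f[THEN borel_measurable_integrable] unfolding integrable_iff_bounded
  by (subst (asm) nn_integral_dilation[OF _ c]) (auto simp: ennreal_mult_less_top c)

lemma integral_dilation:
  fixes f :: "'a::euclidean_space \<Rightarrow> real"
  assumes [measurable]: "f \<in> borel_measurable borel" and c: "c \<noteq> 0"
  shows "(\<integral>x. f (c *\<^sub>R x) \<partial>lborel) = (\<integral>x. f x \<partial>lborel) / \<bar>c\<bar> ^ DIM('a)"
proof -
  have "(\<integral>x. f x \<partial>lborel) = \<bar>c\<bar> ^ DIM('a) * (\<integral>x. f (c *\<^sub>R x) \<partial>lborel)"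
    by (subst lborel_affine[OF c, of 0])
       (simp add: integral_density integral_distr)
  then show ?thesis using c by simp
qed

lemma AE_dilation:
  fixes P :: "'a::euclidean_space \<Rightarrow> bool"
  assumes [measurable]: "Measurable.pred borel P" and c: "c \<noteq> 0" and P: "AE x in lborel. P x"
  shows "AE x in lborel. P (c *\<^sub>R x)"
  using P by (subst (asm) lborel_affine[OF c, of 0]) (simp add: AE_density AE_distr_iff c)

text \<open>Differentiating a dilation produces the factor \<open>c\<close>, so the induction only
  closes for scalar multiples of dilations; hence the extra factor \<open>d\<close>.\<close>

lemma Ck_fun_dilation: "Ck_fun k f \<Longrightarrow> Ck_fun k (\<lambda>x. d * f (c *\<^sub>R x))"
proof (induction k arbitrary: f d)
  case 0
  then have "continuous_on UNIV f" by simp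
  then have "continuous_on UNIV (\<lambda>x. f (c *\<^sub>R x))"
    by (rule continuous_on_compose2[of UNIV f]) (auto intro!: continuous_intros)
  then show ?case by (auto intro!: continuous_intros)
next
  case (Suc k)
  have f: "(f has_derivative frechet_derivative f (at x)) (at x)" for x
    using Suc.prems by (simp add: differentiable_on_def frechet_derivative_works)
  have d: "((\<lambda>x. d * f (c *\<^sub>R x)) has_derivative
      (\<lambda>h. d * frechet_derivative f (at (c *\<^sub>R x)) (c *\<^sub>R h))) (at x)" for x
  proof -
    have "((\<lambda>x. f (c *\<^sub>R x)) has_derivative (\<lambda>h. frechet_derivative f (at (c *\<^sub>R x)) (c *\<^sub>R h))) (at x)"
      by (rule has_derivative_compose[of "\<lambda>x. c *\<^sub>R x" "\<lambda>h. c *\<^sub>R h" x UNIV f])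
         (auto intro!: derivative_eq_intros f)
    then show ?thesis by (auto intro!: derivative_eq_intros)
  qed
  have eq: "frechet_derivative (\<lambda>x. d * f (c *\<^sub>R x)) (at x) (axis i 1)
      = (d * c) * frechet_derivative f (at (c *\<^sub>R x)) (axis i 1)" for x i
  proof -
    have "frechet_derivative f (at (c *\<^sub>R x)) (c *\<^sub>R axis i 1)
        = c *\<^sub>R frechet_derivative f (at (c *\<^sub>R x)) (axis i 1)"
      by (intro linear_cmul has_derivative_linear[OF f])
    then show ?thesis
      by (simp add: frechet_derivative_at[OF d, symmetric])
  qed
  have "(\<lambda>x. d * f (c *\<^sub>R x)) differentiable_on UNIV"
    using d by (auto simp: differentiable_on_def differentiable_def)
  moreover have "Ck_fun k (\<lambda>x. frechet_derivative (\<lambda>x. d * f (c *\<^sub>R x)) (at x) (axis i 1))" for i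
    unfolding eq by (rule Suc.IH) (use Suc.prems in simp)
  ultimately show ?case by simp
qed

lemma test_functions_dilation:
  assumes "f \<in> test_functions" and c: "c \<noteq> 0"
  shows "(\<lambda>x. f (c *\<^sub>R x)) \<in> test_functions"
proof -
  have "compact (closure {x. f (c *\<^sub>R x) \<noteq> 0})"
  proof -
    have "{x. f (c *\<^sub>R x) \<noteq> 0} \<subseteq> (\<lambda>x. (1/c) *\<^sub>R x) ` {x. f x \<noteq> 0}"
    proof
      fix x assume "x \<in> {x. f (c *\<^sub>R x) \<noteq> 0}"
      then show "x \<in> (\<lambda>x. (1/c) *\<^sub>R x) ` {x. f x \<noteq> 0}"
        using c by (intro image_eqI[of _ _ "c *\<^sub>R x"]) auto
    qed
    moreover have "bounded {x. f x \<noteq> 0}"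
      using assms compact_closure by (auto simp: test_functions_def)
    ultimately show ?thesis
      using bounded_scaling bounded_subset compact_closure by metis
  qed
  then show ?thesis
    using assms Ck_fun_dilation[of _ f 1 c] by (simp add: test_functions_def)
qed

section \<open>Scaling of the Gagliardo form and of the Lebesgue norms\<close>

lemma gagliardo_integrand_measurable [measurable]:
  assumes [measurable]: "u \<in> borel_measurable borel" "v \<in> borel_measurable borel"
  shows "gagliardo_integrand s u v \<in> borel_measurable borel"
  unfolding gagliardo_integrand_def borel_prod[symmetric] by measurable

lemma gagliardo_integrand_dilation:
  fixes u v :: "real ^ 'n \<Rightarrow> real"
  assumes "c > 0"
  shows "gagliardo_integrand s (\<lambda>x. u (c *\<^sub>R x)) (\<lambda>x. v (c *\<^sub>R x))
    = (\<lambda>z. c powr (real CARD('n) + 2 * s) * gagliardo_integrand s u v (c *\<^sub>R z))"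
proof
  fix z :: "(real ^ 'n) \<times> (real ^ 'n)"
  obtain x y where z: "z = (x, y)" by fastforce
  have "norm (c *\<^sub>R x - c *\<^sub>R y) = c * norm (x - y)"
    using assms by (simp flip: scaleR_diff_right)
  then show "gagliardo_integrand s (\<lambda>x. u (c *\<^sub>R x)) (\<lambda>x. v (c *\<^sub>R x)) z
      = c powr (real CARD('n) + 2 * s) * gagliardo_integrand s u v (c *\<^sub>R z)"
    using assms by (simp add: gagliardo_integrand_def z powr_mult)
qed

lemma finite_energy_dilation:
  assumes "finite_energy s u" "c > 0"
  shows "finite_energy s (\<lambda>x. u (c *\<^sub>R x))"
  using assms unfolding finite_energy_def lborel_prod
  by (simp add: gagliardo_integrand_dilation integrable_dilation)

text \<open>The kernel, homogeneous of degree -(N + 2s), contributes the exponent N + 2s, and the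
  change of variables in R^(2N) contributes -2N.\<close>

lemma gagliardo_form_dilation:
  fixes u v :: "real ^ 'n \<Rightarrow> real"
  assumes [measurable]: "u \<in> borel_measurable borel" "v \<in> borel_measurable borel" and "c > 0"
  shows "gagliardo_form s (\<lambda>x. u (c *\<^sub>R x)) (\<lambda>x. v (c *\<^sub>R x))
    = c powr (2 * s - real CARD('n)) * gagliardo_form s u v"
proof -
  let ?N = "real CARD('n)"
  have "c powr (?N + 2 * s) / c ^ (2 * CARD('n)) = c powr (?N + 2 * s) / c powr (2 * ?N)"
    using \<open>c > 0\<close> by (simp flip: powr_realpow)
  also have "\<dots> = c powr (2 * s - ?N)"
    by (simp flip: powr_diff)
  finally have "c powr (?N + 2 * s) * (I / c ^ (2 * CARD('n))) = c powr (2 * s - ?N) * I" for I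
    by (metis times_divide_eq_left times_divide_eq_right)
  then show ?thesis
    using \<open>c > 0\<close> unfolding gagliardo_form_def lborel_prod
    by (simp add: gagliardo_integrand_dilation integral_dilation mult_2[symmetric] del: times_divide_eq_right)
qed

lemma Lp_space_dilation:
  assumes "u \<in> Lp_space r" "c \<noteq> 0"
  shows "(\<lambda>x. u (c *\<^sub>R x)) \<in> Lp_space r"
proof -
  have [measurable]: "u \<in> borel_measurable borel"
    using assms by (simp add: Lp_space_def)
  then have "(\<lambda>x. u (c *\<^sub>R x)) \<in> borel_measurable borel" by measurable
  then show ?thesis
    using assms integrable_dilation[of "\<lambda>x. \<bar>u x\<bar> powr r"] by (simp add: Lp_space_def)
qed

lemma Lp_norm_dilation:
  fixes u :: "real ^ 'n \<Rightarrow> real"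
  assumes [measurable]: "u \<in> borel_measurable borel" and "c > 0"
  shows "Lp_norm r (\<lambda>x. u (c *\<^sub>R x)) = (1 / c ^ CARD('n)) powr (1 / r) * Lp_norm r u"
  using \<open>c > 0\<close> unfolding Lp_norm_def
  by (subst integral_dilation[where f="\<lambda>x. \<bar>u x\<bar> powr r"]) (auto simp: powr_divide powr_mult)

lemma test_functions_measurable:
  assumes "f \<in> test_functions"
  shows "f \<in> borel_measurable borel"
proof -
  have "Ck_fun 0 f"
    using assms unfolding test_functions_def by blast
  then show ?thesis
    by (intro borel_measurable_continuous_onI) simp
qed

lemma frac_const_pos: "0 < s \<Longrightarrow> s < 1 \<Longrightarrow> frac_const N s > 0"
  by (auto simp: frac_const_def intro!: divide_pos_pos mult_pos_pos Gamma_real_pos add_nonneg_pos)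

lemma gagliardo_form_nonneg:
  "0 < s \<Longrightarrow> s < 1 \<Longrightarrow> 0 \<le> gagliardo_form s u u"
  by (auto simp: gagliardo_form_def gagliardo_integrand_def split_beta less_imp_le frac_const_pos
      intro!: mult_nonneg_nonneg integral_nonneg)

text \<open>Dilating the approximating test functions multiplies each of the two error norms by a
  factor independent of \<open>k\<close>, so convergence survives. This makes dilations of a
  solution admissible in its weak equation.\<close>

lemma Hdot_dilation:
  fixes u :: "real ^ 'n \<Rightarrow> real"
  assumes u: "u \<in> Hdot s" and s: "0 < s" "s < 1" and c: "c > 0"
  shows "(\<lambda>x. u (c *\<^sub>R x)) \<in> Hdot s"
proof -
  let ?r = "crit_exp CARD('n) s"
  have [measurable]: "u \<in> borel_measurable borel"
    using u by (simp add: Hdot_def Lp_space_def)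
  obtain \<phi> where \<phi>: "\<And>k. \<phi> k \<in> test_functions"
    and lim: "(\<lambda>k. Hdot_norm s (\<lambda>x. u x - \<phi> k x) + Lp_norm ?r (\<lambda>x. u x - \<phi> k x)) \<longlonglongrightarrow> 0"
    using u by (auto simp: Hdot_def)
  have [measurable]: "\<phi> k \<in> borel_measurable borel" for k
    using \<phi> by (rule test_functions_measurable)
  have nonneg: "0 \<le> Lp_norm ?r (\<lambda>x. u x - \<phi> k x)" for k
    by (simp add: Lp_norm_def)
  have nonneg': "0 \<le> Hdot_norm s (\<lambda>x. u x - \<phi> k x)" for k
    using s by (simp add: Hdot_norm_def gagliardo_form_nonneg)
  \<comment> \<open>The two norms scale by different factors, so the convergence of their sum is
    first split, using that both terms are nonnegative.\<close>
  have "(\<lambda>k. Hdot_norm s (\<lambda>x. u x - \<phi> k x)) \<longlonglongrightarrow> 0"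
    by (rule tendsto_sandwich[OF _ _ tendsto_const lim]) (auto simp: nonneg nonneg')
  moreover have "(\<lambda>k. Lp_norm ?r (\<lambda>x. u x - \<phi> k x)) \<longlonglongrightarrow> 0"
    by (rule tendsto_sandwich[OF _ _ tendsto_const lim]) (auto simp: nonneg nonneg')
  ultimately have "(\<lambda>k. sqrt (c powr (2 * s - real CARD('n))) * Hdot_norm s (\<lambda>x. u x - \<phi> k x)
      + (1 / c ^ CARD('n)) powr (1 / ?r) * Lp_norm ?r (\<lambda>x. u x - \<phi> k x)) \<longlonglongrightarrow> 0"
    by (intro tendsto_add_zero tendsto_mult_right_zero)
  moreover have "Hdot_norm s (\<lambda>x. u (c *\<^sub>R x) - \<phi> k (c *\<^sub>R x))
      = sqrt (c powr (2 * s - real CARD('n))) * Hdot_norm s (\<lambda>x. u x - \<phi> k x)" for k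
    using gagliardo_form_dilation[of "\<lambda>x. u x - \<phi> k x" "\<lambda>x. u x - \<phi> k x" c s] c
    by (simp add: Hdot_norm_def real_sqrt_mult)
  moreover have "Lp_norm ?r (\<lambda>x. u (c *\<^sub>R x) - \<phi> k (c *\<^sub>R x))
      = (1 / c ^ CARD('n)) powr (1 / ?r) * Lp_norm ?r (\<lambda>x. u x - \<phi> k x)" for k
    using c by (intro Lp_norm_dilation[of "\<lambda>x. u x - \<phi> k x" c]) auto
  ultimately have "(\<lambda>k. Hdot_norm s (\<lambda>x. u (c *\<^sub>R x) - \<phi> k (c *\<^sub>R x))
      + Lp_norm ?r (\<lambda>x. u (c *\<^sub>R x) - \<phi> k (c *\<^sub>R x))) \<longlonglongrightarrow> 0"
    by simp
  moreover have "(\<lambda>x. \<phi> k (c *\<^sub>R x)) \<in> test_functions" for k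
    using \<phi> c by (intro test_functions_dilation) auto
  moreover have "(\<lambda>x. u (c *\<^sub>R x)) \<in> Lp_space ?r" "finite_energy s (\<lambda>x. u (c *\<^sub>R x))"
    using u c by (auto simp: Hdot_def intro: Lp_space_dilation finite_energy_dilation)
  ultimately show ?thesis
    unfolding Hdot_def mem_Collect_eq by (intro conjI exI[of _ "\<lambda>k x. \<phi> k (c *\<^sub>R x)"] allI)
qed

section \<open>Fractional Sobolev and dilation estimates\<close>

text \<open>The inner integral of the squared Gagliardo seminorm, without the constant. It is
  \<open>ennreal\<close>-valued because it may be infinite at some points.\<close>

definition gagliardo_density :: "real \<Rightarrow> ('a::euclidean_space \<Rightarrow> real) \<Rightarrow> 'a \<Rightarrow> ennreal" where
  "gagliardo_density s w x =
     (\<integral>\<^sup>+y. ennreal ((w x - w y)\<^sup>2 / norm (x - y) powr (real DIM('a) + 2 * s)) \<partial>lborel)"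

lemma gagliardo_density_measurable [measurable]:
  fixes w :: "'a::euclidean_space \<Rightarrow> real"
  assumes [measurable]: "w \<in> borel_measurable borel"
  shows "gagliardo_density s w \<in> borel_measurable borel"
  unfolding gagliardo_density_def[abs_def] by measurable

lemma ball_sets_borel [measurable]: "ball x \<rho> \<in> sets borel"
  by simp

text \<open>For 0 < |x - y| < \<open>\<rho>\<close> the kernel is at least \<open>\<rho>\<close> to
  the power -(N + 2s); at y = x the integrand on the left vanishes.\<close>

lemma nn_integral_ball_diff_le:
  fixes w :: "'a::euclidean_space \<Rightarrow> real"
  assumes [measurable]: "w \<in> borel_measurable borel" and "0 < s" "0 < \<rho>"
  shows "(\<integral>\<^sup>+y. ennreal ((w x - w y)\<^sup>2) * indicator (ball x \<rho>) y \<partial>lborel)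
    \<le> ennreal (\<rho> powr (real DIM('a) + 2 * s)) * gagliardo_density s w x"
proof -
  let ?d = "real DIM('a) + 2 * s"
  have "(\<integral>\<^sup>+y. ennreal ((w x - w y)\<^sup>2) * indicator (ball x \<rho>) y \<partial>lborel)
     \<le> (\<integral>\<^sup>+y. ennreal (\<rho> powr ?d) * ennreal ((w x - w y)\<^sup>2 / norm (x - y) powr ?d) \<partial>lborel)"
  proof (rule nn_integral_mono)
    fix y
    show "ennreal ((w x - w y)\<^sup>2) * indicator (ball x \<rho>) y
        \<le> ennreal (\<rho> powr ?d) * ennreal ((w x - w y)\<^sup>2 / norm (x - y) powr ?d)"
    proof (cases "y \<in> ball x \<rho> \<and> x \<noteq> y")
      case True
      then have "norm (x - y) powr ?d \<le> \<rho> powr ?d" "0 < norm (x - y) powr ?d"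
        using \<open>0 < s\<close> by (auto simp: dist_norm intro!: powr_mono2)
      then have "(w x - w y)\<^sup>2 \<le> \<rho> powr ?d * ((w x - w y)\<^sup>2 / norm (x - y) powr ?d)"
        by (simp add: field_simps mult_left_mono)
      then show ?thesis
        using True by (simp flip: ennreal_mult)
    next
      case False
      then show ?thesis by (cases "x = y") auto
    qed
  qed
  also have "\<dots> = ennreal (\<rho> powr ?d) * gagliardo_density s w x"
    unfolding gagliardo_density_def by (rule nn_integral_cmult) measurable
  finally show ?thesis .
qed

text \<open>The optimization behind the pointwise bound, isolated as a statement about reals. In the
  application \<open>a\<close> is |w x|, \<open>g\<close> the density at \<open>x\<close>,
  \<open>M\<close> the integral of |w|^r and \<open>\<omega>\<close> the volume of the unit ball;
  \<open>le\<close> comes from averaging over a ball of radius \<open>\<rho>\<close> after splitting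
  \<open>w\<close> at height \<open>\<eta>\<close>.\<close>

lemma sobolev_balance:
  fixes N s r g M a \<omega> :: real
  assumes "0 < s" "2 * s < N" and r: "r = 2 * N / (N - 2 * s)"
    and "0 < M" "0 < \<omega>" "0 < a"
    and le: "\<And>\<rho> \<eta>. 0 < \<rho> \<Longrightarrow> 0 < \<eta> \<Longrightarrow>
      a\<^sup>2 * (\<omega> * \<rho> powr N) \<le> 2 * \<rho> powr (N + 2 * s) * g + 2 * \<eta>\<^sup>2 * (\<omega> * \<rho> powr N) + 2 * \<eta> powr (2 - r) * M"
  shows "a powr r \<le> 4 / \<omega> * (4 powr r / \<omega>) powr (2 * s / N) * M powr (2 * s / N) * g"
proof -
  have "0 < N" using assms by linarith
  \<comment> \<open>With \<open>\<eta> = a / 4\<close>, this radius makes each of the last two terms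
    of \<open>le\<close> equal to one eighth of its left-hand side, so that they can be
    absorbed.\<close>
  define \<rho> where "\<rho> = (4 powr r * M * a powr (- r) / \<omega>) powr (1 / N)"
  have "0 < \<rho>" using assms by (simp add: \<rho>_def)
  have \<rho>N: "\<omega> * \<rho> powr N = 4 powr r * M * a powr (- r)"
    using \<open>0 < N\<close> assms by (simp add: \<rho>_def powr_powr)
  have exps: "r * (2 * s / N) = r - 2"
    using \<open>2 * s < N\<close> \<open>0 < N\<close> by (simp add: r field_simps)
  have \<rho>s: "\<rho> powr (2 * s) = (4 powr r / \<omega>) powr (2 * s / N) * M powr (2 * s / N) * a powr (2 - r)"
  proof -
    have "4 powr r * M * a powr (- r) / \<omega> = 4 powr r / \<omega> * M * a powr (- r)"
      by simp
    then have "\<rho> powr (2 * s) = (4 powr r / \<omega> * M * a powr (- r)) powr (2 * s / N)"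
      unfolding \<rho>_def by (simp only: powr_powr) simp
    also have "\<dots> = (4 powr r / \<omega>) powr (2 * s / N) * M powr (2 * s / N) * a powr (- (r * (2 * s / N)))"
      by (simp only: powr_mult powr_powr minus_mult_left)
    finally show ?thesis unfolding exps by simp
  qed
  have "(a / 4) powr (2 - r) = 4 powr (r - 2) * a powr (2 - r)"
    using \<open>0 < a\<close> powr_minus_divide[of 4 "r - 2"] by (simp add: powr_divide)
  also have "a powr (2 - r) = a\<^sup>2 * a powr (- r)"
    using \<open>0 < a\<close> by (simp add: powr_diff powr_minus_divide)
  also have "4 powr (r - 2) = 4 powr r / 16"
    by (simp add: powr_diff)
  finally have "2 * (a / 4) powr (2 - r) * M = a\<^sup>2 * (4 powr r * M * a powr (- r)) / 8"
    unfolding \<rho>N by (simp add: mult_ac)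
  moreover have "2 * (a / 4)\<^sup>2 * (\<omega> * \<rho> powr N) = a\<^sup>2 * (\<omega> * \<rho> powr N) / 8"
    by (simp add: power_divide)
  moreover have "2 * (a / 4) powr (2 - r) * M = a\<^sup>2 * (\<omega> * \<rho> powr N) / 8"
    using calculation(1) unfolding \<rho>N .
  moreover have "a\<^sup>2 * (\<omega> * \<rho> powr N) \<le> 2 * \<rho> powr (N + 2 * s) * g
      + 2 * (a / 4)\<^sup>2 * (\<omega> * \<rho> powr N) + 2 * (a / 4) powr (2 - r) * M"
    using \<open>0 < \<rho>\<close> \<open>0 < a\<close> by (intro le) auto
  ultimately have "a\<^sup>2 * (\<omega> * \<rho> powr N) \<le> 2 * \<rho> powr (N + 2 * s) * g + a\<^sup>2 * (\<omega> * \<rho> powr N) / 4"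
    by linarith
  moreover have "0 \<le> a\<^sup>2 * (\<omega> * \<rho> powr N)"
    using assms by simp
  ultimately have "a\<^sup>2 * (\<omega> * \<rho> powr N) \<le> 4 * \<rho> powr (N + 2 * s) * g"
    by linarith
  then have "\<rho> powr N * (\<omega> * a\<^sup>2) \<le> \<rho> powr N * (4 * \<rho> powr (2 * s) * g)"
    by (simp add: powr_add mult_ac)
  then have "\<omega> * a\<^sup>2 \<le> 4 * \<rho> powr (2 * s) * g"
    by (rule mult_left_le_imp_le) (use \<open>0 < \<rho>\<close> in simp)
  \<comment> \<open>The factor cancels the power \<open>a powr (2 - r)\<close> contained in
    \<open>\<rho> powr (2 * s)\<close>.\<close>
  then have "a powr (r - 2) * (\<omega> * a\<^sup>2) \<le> a powr (r - 2) * (4 * \<rho> powr (2 * s) * g)"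
    by (intro mult_left_mono) auto
  moreover have "a powr (r - 2) * (\<omega> * a\<^sup>2) = \<omega> * a powr r"
    using \<open>0 < a\<close> by (simp add: powr_diff)
  moreover have "a powr (r - 2) * (4 * \<rho> powr (2 * s) * g)
      = 4 * (4 powr r / \<omega>) powr (2 * s / N) * M powr (2 * s / N) * g"
  proof -
    have "a powr (r - 2) * a powr (2 - r) = 1"
      using \<open>0 < a\<close> by (simp flip: powr_add)
    then show ?thesis unfolding \<rho>s by (simp add: algebra_simps)
  qed
  ultimately have "\<omega> * a powr r \<le> 4 * (4 powr r / \<omega>) powr (2 * s / N) * M powr (2 * s / N) * g"
    by metis
  then show ?thesis
    using \<open>0 < \<omega>\<close> by (simp add: pos_le_divide_eq mult_ac)
qed

text \<open>
  Hedberg's trick: compare \<open>w x\<close> with its averages over the ball of the radius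
  at which the oscillation and the \<open>L\<^sup>r\<close> bound balance.
\<close>

lemma powr_le_gagliardo_density:
  fixes w :: "'a::euclidean_space \<Rightarrow> real"
  defines "N \<equiv> real DIM('a)" and "\<omega> \<equiv> unit_ball_vol (real DIM('a))"
  assumes [measurable]: "w \<in> borel_measurable borel" and s: "0 < s" "2 * s < N"
    and r: "r = 2 * N / (N - 2 * s)" and int: "integrable lborel (\<lambda>x. \<bar>w x\<bar> powr r)"
    and M: "M = (\<integral>x. \<bar>w x\<bar> powr r \<partial>lborel)" "0 < M"
  shows "ennreal (\<bar>w x\<bar> powr r)
    \<le> ennreal (4 / \<omega> * (4 powr r / \<omega>) powr (2 * s / N) * M powr (2 * s / N)) * gagliardo_density s w x"
proof (cases "w x = 0 \<or> gagliardo_density s w x = \<infinity>")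
  case True
  have "0 < \<omega>" by (simp add: \<omega>_def)
  then have "0 < 4 / \<omega> * (4 powr r / \<omega>) powr (2 * s / N) * M powr (2 * s / N)"
    using \<open>0 < M\<close> by simp
  with True show ?thesis by (auto simp: ennreal_mult_top ennreal_eq_0_iff simp del: mult_eq_0_iff divide_eq_0_iff)
next
  case False
  then obtain g where g: "gagliardo_density s w x = ennreal g" "0 \<le> g"
    by (cases "gagliardo_density s w x") auto
  have "0 < \<omega>" by (simp add: \<omega>_def)
  have "2 < r"
    using s by (simp add: r field_simps)
  have "\<bar>w x\<bar> powr r \<le> 4 / \<omega> * (4 powr r / \<omega>) powr (2 * s / N) * M powr (2 * s / N) * g"
  proof (rule sobolev_balance[OF s r \<open>0 < M\<close> \<open>0 < \<omega>\<close>])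
    show "0 < \<bar>w x\<bar>" using False by simp
    fix \<rho> \<eta> :: real assume "0 < \<rho>" "0 < \<eta>"
    have vol: "emeasure lborel (ball x \<rho>) = ennreal (\<omega> * \<rho> powr N)"
      using \<open>0 < \<rho>\<close> by (simp add: emeasure_ball \<omega>_def N_def powr_realpow)
    \<comment> \<open>Values up to height \<open>\<eta>\<close> contribute at most their squared
      bound; above it, r > 2 trades the square for the r-th power.\<close>
    have small: "(w y)\<^sup>2 \<le> \<eta>\<^sup>2 + \<eta> powr (2 - r) * \<bar>w y\<bar> powr r" for y
    proof (cases "\<bar>w y\<bar> \<le> \<eta>")
      case True
      then have "(w y)\<^sup>2 \<le> \<eta>\<^sup>2" using power_mono[of "\<bar>w y\<bar>" \<eta> 2] by simp
      then show ?thesis by (simp add: add_increasing2)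
    next
      case False
      then have "\<eta> powr (r - 2) \<le> \<bar>w y\<bar> powr (r - 2)"
        using \<open>0 < \<eta>\<close> \<open>2 < r\<close> by (intro powr_mono2) auto
      then have "\<bar>w y\<bar>\<^sup>2 * \<eta> powr (r - 2) \<le> \<bar>w y\<bar>\<^sup>2 * \<bar>w y\<bar> powr (r - 2)"
        by (intro mult_left_mono) auto
      also have "\<dots> = \<bar>w y\<bar> powr r"
        using False \<open>0 < \<eta>\<close> by (simp add: powr_diff)
      finally have "\<eta> powr (2 - r) * (\<bar>w y\<bar>\<^sup>2 * \<eta> powr (r - 2)) \<le> \<eta> powr (2 - r) * \<bar>w y\<bar> powr r"
        by (intro mult_left_mono) auto
      moreover have "\<eta> powr (2 - r) * \<eta> powr (r - 2) = 1"
        using \<open>0 < \<eta>\<close> by (simp flip: powr_add)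
      ultimately have "\<bar>w y\<bar>\<^sup>2 \<le> \<eta> powr (2 - r) * \<bar>w y\<bar> powr r"
        by (metis mult.left_commute mult.right_neutral)
      then show ?thesis by (simp add: add_increasing)
    qed
    have pt: "(w x)\<^sup>2 \<le> 2 * (w x - w y)\<^sup>2 + (2 * \<eta>\<^sup>2 + 2 * \<eta> powr (2 - r) * \<bar>w y\<bar> powr r)" for y
    proof -
      have "(w x)\<^sup>2 \<le> 2 * (w x - w y)\<^sup>2 + 2 * (w y)\<^sup>2"
        using zero_le_power2[of "w x - 2 * w y"] by (simp add: power2_eq_square algebra_simps)
      then show ?thesis using small[of y] by (simp add: algebra_simps)
    qed
    have "ennreal ((w x)\<^sup>2) * emeasure lborel (ball x \<rho>)
        = (\<integral>\<^sup>+y. ennreal ((w x)\<^sup>2) * indicator (ball x \<rho>) y \<partial>lborel)"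
      by (simp add: nn_integral_cmult_indicator)
    also have "\<dots> \<le> (\<integral>\<^sup>+y. 2 * (ennreal ((w x - w y)\<^sup>2) * indicator (ball x \<rho>) y)
        + (ennreal (2 * \<eta>\<^sup>2) * indicator (ball x \<rho>) y
        + ennreal (2 * \<eta> powr (2 - r)) * ennreal (\<bar>w y\<bar> powr r)) \<partial>lborel)"
    proof (rule nn_integral_mono)
      fix y
      have "ennreal ((w x)\<^sup>2) \<le> 2 * ennreal ((w x - w y)\<^sup>2)
          + (ennreal (2 * \<eta>\<^sup>2) + ennreal (2 * \<eta> powr (2 - r)) * ennreal (\<bar>w y\<bar> powr r))"
        using ennreal_leI[OF pt[of y]] by (simp add: ennreal_plus ennreal_mult)
      then show "ennreal ((w x)\<^sup>2) * indicator (ball x \<rho>) y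
          \<le> 2 * (ennreal ((w x - w y)\<^sup>2) * indicator (ball x \<rho>) y)
        + (ennreal (2 * \<eta>\<^sup>2) * indicator (ball x \<rho>) y
        + ennreal (2 * \<eta> powr (2 - r)) * ennreal (\<bar>w y\<bar> powr r))"
        by (auto simp: indicator_def)
    qed
    also have "\<dots> = 2 * (\<integral>\<^sup>+y. ennreal ((w x - w y)\<^sup>2) * indicator (ball x \<rho>) y \<partial>lborel)
        + (ennreal (2 * \<eta>\<^sup>2) * emeasure lborel (ball x \<rho>)
        + ennreal (2 * \<eta> powr (2 - r)) * ennreal M)"
    proof -
      have "(\<integral>\<^sup>+y. ennreal (\<bar>w y\<bar> powr r) \<partial>lborel) = ennreal M"
        using nn_integral_eq_integral[OF int] M by simp
      moreover have "(\<lambda>y. ennreal ((w x - w y)\<^sup>2) * indicator (ball x \<rho>) y) \<in> borel_measurable lborel"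
        "(\<lambda>y. ennreal (\<bar>w y\<bar> powr r)) \<in> borel_measurable lborel"
        by (measurable, measurable)
      ultimately show ?thesis
        by (simp add: nn_integral_add nn_integral_cmult nn_integral_cmult_indicator)
    qed
    also have "\<dots> \<le> 2 * (ennreal (\<rho> powr (N + 2 * s)) * ennreal g)
        + (ennreal (2 * \<eta>\<^sup>2) * ennreal (\<omega> * \<rho> powr N)
        + ennreal (2 * \<eta> powr (2 - r)) * ennreal M)"
      using nn_integral_ball_diff_le[of w s \<rho> x] \<open>0 < \<rho>\<close> s(1)
      unfolding vol g(1) N_def by (intro add_mono mult_left_mono) auto
    also have "\<dots> = ennreal (2 * \<rho> powr (N + 2 * s) * g + 2 * \<eta>\<^sup>2 * (\<omega> * \<rho> powr N) + 2 * \<eta> powr (2 - r) * M)"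
      using \<open>0 < \<omega>\<close> \<open>0 < M\<close> g(2)
      by (simp add: ennreal_plus ennreal_mult mult.assoc add.assoc)
    finally have "ennreal ((w x)\<^sup>2 * (\<omega> * \<rho> powr N))
        \<le> ennreal (2 * \<rho> powr (N + 2 * s) * g + 2 * \<eta>\<^sup>2 * (\<omega> * \<rho> powr N) + 2 * \<eta> powr (2 - r) * M)"
      unfolding vol using \<open>0 < \<omega>\<close> by (simp add: ennreal_mult)
    then show "\<bar>w x\<bar>\<^sup>2 * (\<omega> * \<rho> powr N)
        \<le> 2 * \<rho> powr (N + 2 * s) * g + 2 * \<eta>\<^sup>2 * (\<omega> * \<rho> powr N) + 2 * \<eta> powr (2 - r) * M"
      using \<open>0 < \<omega>\<close> \<open>0 < M\<close> g(2) by (subst (asm) ennreal_le_iff) auto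
  qed
  then have "ennreal (\<bar>w x\<bar> powr r)
      \<le> ennreal (4 / \<omega> * (4 powr r / \<omega>) powr (2 * s / N) * M powr (2 * s / N) * g)"
    by (rule ennreal_leI)
  then show ?thesis
    using g \<open>0 < \<omega>\<close> by (simp flip: ennreal_mult)
qed

text \<open>Integrating the pointwise bound gives M <= C * M^(2s/N) * e, and 1 - 2s/N = 2/r. The
  division is legitimate because \<open>M\<close> is finite by the integrability hypothesis.
  \<open>C\<close> is chosen before \<open>w\<close>, since it is applied to the increments of all
  dilations at once.\<close>

lemma fractional_sobolev:
  fixes s :: real
  defines "N \<equiv> real DIM('a::euclidean_space)"
  assumes s: "0 < s" "2 * s < N" and r: "r = 2 * N / (N - 2 * s)"
  obtains C where "0 < C" "\<And>(w :: 'a \<Rightarrow> real) e. w \<in> borel_measurable borel \<Longrightarrow>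
    integrable lborel (\<lambda>x. \<bar>w x\<bar> powr r) \<Longrightarrow> 0 \<le> e \<Longrightarrow>
    (\<integral>\<^sup>+x. gagliardo_density s w x \<partial>lborel) = ennreal e \<Longrightarrow>
    (\<integral>x. \<bar>w x\<bar> powr r \<partial>lborel) powr (2 / r) \<le> C * e"
proof -
  define \<omega> where "\<omega> = unit_ball_vol (real DIM('a))"
  define C where "C = 4 / \<omega> * (4 powr r / \<omega>) powr (2 * s / N)"
  have "0 < \<omega>" by (simp add: \<omega>_def)
  then have "0 < C" by (simp add: C_def)
  have "0 < N" using s by linarith
  have "(\<integral>x. \<bar>w x\<bar> powr r \<partial>lborel) powr (2 / r) \<le> C * e"
    if [measurable]: "w \<in> borel_measurable borel" and int: "integrable lborel (\<lambda>x. \<bar>w x\<bar> powr r)"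
      and "0 \<le> e" and e: "(\<integral>\<^sup>+x. gagliardo_density s w x \<partial>lborel) = ennreal e"
    for w :: "'a \<Rightarrow> real" and e
  proof -
    define M where "M = (\<integral>x. \<bar>w x\<bar> powr r \<partial>lborel)"
    have "0 \<le> M" by (simp add: M_def)
    show ?thesis
    proof (cases "M = 0")
      case True
      then show ?thesis using \<open>0 < C\<close> \<open>0 \<le> e\<close> by (simp add: M_def)
    next
      case False
      with \<open>0 \<le> M\<close> have "0 < M" by simp
      have "ennreal M = (\<integral>\<^sup>+x. ennreal (\<bar>w x\<bar> powr r) \<partial>lborel)"
        using nn_integral_eq_integral[OF int] by (simp add: M_def)
      also have "\<dots> \<le> (\<integral>\<^sup>+x. ennreal (C * M powr (2 * s / N)) * gagliardo_density s w x \<partial>lborel)"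
        unfolding C_def \<omega>_def
        using s r int M_def \<open>0 < M\<close> unfolding N_def
        by (intro nn_integral_mono powr_le_gagliardo_density) auto
      also have "\<dots> = ennreal (C * M powr (2 * s / N) * e)"
        using \<open>0 < C\<close> \<open>0 \<le> e\<close> by (simp add: nn_integral_cmult e ennreal_mult)
      finally have "M \<le> C * M powr (2 * s / N) * e"
        using \<open>0 < C\<close> \<open>0 \<le> e\<close> by (subst (asm) ennreal_le_iff) auto
      moreover have "M = M powr (2 * s / N) * M powr (2 / r)"
      proof -
        have "2 * s / N + 2 / r = 1"
          using \<open>0 < N\<close> s by (simp add: r field_simps)
        then show ?thesis using \<open>0 < M\<close> powr_add[of M "2 * s / N" "2 / r"] by simp
      qed
      ultimately have "M powr (2 * s / N) * M powr (2 / r) \<le> M powr (2 * s / N) * (C * e)"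
        by (simp add: mult_ac)
      then show ?thesis
        unfolding M_def[symmetric] by (rule mult_left_le_imp_le) (use \<open>0 < M\<close> in simp)
    qed
  qed
  with \<open>0 < C\<close> show thesis by (rule that)
qed

text \<open>For |x| < R the points \<open>x\<close> and \<open>l *\<^sub>R x\<close> are at distance
  at most (1 - l) * R. Both values of \<open>w\<close> are compared with its values on the ball of
  this radius around \<open>x\<close>, and each comparison is paid for by the density at the
  respective point.\<close>

lemma nn_integral_dilation_diff_le:
  fixes w :: "'a::euclidean_space \<Rightarrow> real"
  assumes [measurable]: "w \<in> borel_measurable borel" and "0 < s" "0 < R" "1 / 2 \<le> l" "l < 1"
  shows "(\<integral>\<^sup>+x. ennreal ((w (l *\<^sub>R x) - w x)\<^sup>2) * indicator (ball 0 R) x \<partial>lborel)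
    \<le> ennreal (2 * 2 powr (real DIM('a) + 2 * s) * (2 ^ DIM('a) + 1) * R powr (2 * s)
        / unit_ball_vol (real DIM('a)) * (1 - l) powr (2 * s))
      * (\<integral>\<^sup>+x. gagliardo_density s w x \<partial>lborel)"
proof -
  let ?N = "real DIM('a)" and ?G = "gagliardo_density s w"
  define \<rho> where "\<rho> = (1 - l) * R"
  have "0 < \<rho>" using assms by (simp add: \<rho>_def)
  define \<omega> where "\<omega> = unit_ball_vol (real DIM('a))"
  have "0 < \<omega>" by (simp add: \<omega>_def)
  \<comment> \<open>This is 2 * (2 * \<open>\<rho>\<close>)^(N + 2s) divided by the volume of the
    ball of radius \<open>\<rho>\<close>.\<close>
  define K where "K = 2 * 2 powr (?N + 2 * s) * \<rho> powr (2 * s) / \<omega>"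
  have "0 \<le> K" using \<open>0 < \<omega>\<close> by (simp add: K_def)
  have pt: "ennreal ((w (l *\<^sub>R x) - w x)\<^sup>2) * indicator (ball 0 R) x
      \<le> ennreal K * (?G (l *\<^sub>R x) + ?G x)" for x
  proof (cases "x \<in> ball 0 R")
    case True
    let ?D = "(w (l *\<^sub>R x) - w x)\<^sup>2"
    have V: "emeasure lborel (ball x \<rho>) = ennreal (\<omega> * \<rho> powr ?N)"
      using \<open>0 < \<rho>\<close> by (simp add: emeasure_ball powr_realpow \<omega>_def)
    have sub: "ball x \<rho> \<subseteq> ball (l *\<^sub>R x) (2 * \<rho>)"
    proof
      fix y assume "y \<in> ball x \<rho>"
      moreover have "dist (l *\<^sub>R x) x = (1 - l) * norm x"
      proof -
        have "x - l *\<^sub>R x = (1 - l) *\<^sub>R x" by (simp add: scaleR_left_diff_distrib)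
        then have "dist x (l *\<^sub>R x) = norm ((1 - l) *\<^sub>R x)" by (simp only: dist_norm)
        then show ?thesis using \<open>l < 1\<close> by (simp add: dist_commute)
      qed
      moreover have "(1 - l) * norm x \<le> \<rho>"
        using True \<open>l < 1\<close> by (auto simp: \<rho>_def intro!: mult_left_mono)
      ultimately show "y \<in> ball (l *\<^sub>R x) (2 * \<rho>)"
        using dist_triangle[of "l *\<^sub>R x" y x] by auto
    qed
    have "ennreal ?D * emeasure lborel (ball x \<rho>)
        = (\<integral>\<^sup>+y. ennreal ?D * indicator (ball x \<rho>) y \<partial>lborel)"
      by (simp add: nn_integral_cmult_indicator)
    also have "\<dots> \<le> (\<integral>\<^sup>+y. 2 * (ennreal ((w (l *\<^sub>R x) - w y)\<^sup>2) * indicator (ball (l *\<^sub>R x) (2 * \<rho>)) y)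
        + 2 * (ennreal ((w x - w y)\<^sup>2) * indicator (ball x (2 * \<rho>)) y) \<partial>lborel)"
    proof (rule nn_integral_mono)
      fix y
      show "ennreal ?D * indicator (ball x \<rho>) y
        \<le> 2 * (ennreal ((w (l *\<^sub>R x) - w y)\<^sup>2) * indicator (ball (l *\<^sub>R x) (2 * \<rho>)) y)
        + 2 * (ennreal ((w x - w y)\<^sup>2) * indicator (ball x (2 * \<rho>)) y)"
      proof (cases "y \<in> ball x \<rho>")
        case True
        have "?D \<le> 2 * (w (l *\<^sub>R x) - w y)\<^sup>2 + 2 * (w x - w y)\<^sup>2"
          using zero_le_power2[of "(w (l *\<^sub>R x) - w y) + (w x - w y)"]
          by (simp add: power2_eq_square algebra_simps)
        then have "ennreal ?D \<le> 2 * ennreal ((w (l *\<^sub>R x) - w y)\<^sup>2) + 2 * ennreal ((w x - w y)\<^sup>2)"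
          by (simp flip: ennreal_mult ennreal_plus ennreal_numeral)
        moreover have "y \<in> ball x (2 * \<rho>)" using True \<open>0 < \<rho>\<close> by auto
        ultimately show ?thesis using True sub by auto
      qed simp
    qed
    also have "\<dots> \<le> 2 * (ennreal ((2 * \<rho>) powr (?N + 2 * s)) * ?G (l *\<^sub>R x))
        + 2 * (ennreal ((2 * \<rho>) powr (?N + 2 * s)) * ?G x)"
      using \<open>0 < \<rho>\<close> \<open>0 < s\<close>
      by (subst nn_integral_add) (auto simp: nn_integral_cmult intro!: add_mono mult_left_mono nn_integral_ball_diff_le)
    also have "\<dots> = ennreal (2 * (2 * \<rho>) powr (?N + 2 * s)) * (?G (l *\<^sub>R x) + ?G x)"
      by (simp add: ennreal_mult distrib_left mult.assoc)
    also have "2 * (2 * \<rho>) powr (?N + 2 * s) = K * (\<omega> * \<rho> powr ?N)"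
      using \<open>0 < \<rho>\<close> \<open>0 < \<omega>\<close> by (simp add: K_def powr_mult powr_add)
    finally have "ennreal (\<omega> * \<rho> powr ?N) * ennreal ?D
        \<le> ennreal (\<omega> * \<rho> powr ?N) * (ennreal K * (?G (l *\<^sub>R x) + ?G x))"
      unfolding V using \<open>0 \<le> K\<close> \<open>0 < \<omega>\<close> by (simp add: ennreal_mult mult_ac)
    then have "ennreal ?D \<le> ennreal K * (?G (l *\<^sub>R x) + ?G x)"
      using mult_pos_pos[OF \<open>0 < \<omega>\<close>, of "\<rho> powr ?N"] \<open>0 < \<rho>\<close>
      by (subst (asm) ennreal_mult_le_mult_iff) (auto simp: ennreal_eq_0_iff not_le simp del: zero_less_mult_iff)
    then show ?thesis using True by simp
  qed simp
  have G: "(\<integral>\<^sup>+x. ?G (l *\<^sub>R x) \<partial>lborel) \<le> ennreal (2 ^ DIM('a)) * (\<integral>\<^sup>+x. ?G x \<partial>lborel)"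
  proof -
    \<comment> \<open>As l >= 1/2, the Jacobian l^(-N) is at most 2^N; multiplying by (2l)^N >= 1
      avoids a division in \<open>ennreal\<close>.\<close>
    have "1 \<le> (2 * l) ^ DIM('a)"
      using assms by (intro one_le_power) simp
    then have "1 \<le> 2 ^ DIM('a) * l ^ DIM('a)"
      by (simp only: power_mult_distrib)
    then have "1 * (\<integral>\<^sup>+x. ?G (l *\<^sub>R x) \<partial>lborel)
        \<le> ennreal (2 ^ DIM('a) * l ^ DIM('a)) * (\<integral>\<^sup>+x. ?G (l *\<^sub>R x) \<partial>lborel)"
      by (intro mult_right_mono) (auto simp: ennreal_ge_1)
    also have "\<dots> = ennreal (2 ^ DIM('a)) * (ennreal (\<bar>l\<bar> ^ DIM('a)) * (\<integral>\<^sup>+x. ?G (l *\<^sub>R x) \<partial>lborel))"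
      using assms by (simp add: ennreal_mult mult.assoc)
    also have "ennreal (\<bar>l\<bar> ^ DIM('a)) * (\<integral>\<^sup>+x. ?G (l *\<^sub>R x) \<partial>lborel) = (\<integral>\<^sup>+x. ?G x \<partial>lborel)"
      using assms by (intro nn_integral_dilation[symmetric]) auto
    finally show ?thesis by simp
  qed
  have "(\<integral>\<^sup>+x. ennreal ((w (l *\<^sub>R x) - w x)\<^sup>2) * indicator (ball 0 R) x \<partial>lborel)
      \<le> (\<integral>\<^sup>+x. ennreal K * (?G (l *\<^sub>R x) + ?G x) \<partial>lborel)"
    by (rule nn_integral_mono) (rule pt)
  also have "\<dots> = ennreal K * ((\<integral>\<^sup>+x. ?G (l *\<^sub>R x) \<partial>lborel) + (\<integral>\<^sup>+x. ?G x \<partial>lborel))"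
    by (simp add: nn_integral_cmult nn_integral_add)
  also have "\<dots> \<le> ennreal K * (ennreal (2 ^ DIM('a)) * (\<integral>\<^sup>+x. ?G x \<partial>lborel) + (\<integral>\<^sup>+x. ?G x \<partial>lborel))"
    by (intro mult_left_mono add_right_mono G) simp
  also have "\<dots> = ennreal K * (ennreal (2 ^ DIM('a) + 1) * (\<integral>\<^sup>+x. ?G x \<partial>lborel))"
    by (simp add: ennreal_plus distrib_right)
  also have "\<dots> = ennreal (K * (2 ^ DIM('a) + 1)) * (\<integral>\<^sup>+x. ?G x \<partial>lborel)"
    using \<open>0 \<le> K\<close> by (simp add: ennreal_mult mult.assoc)
  also have "K * (2 ^ DIM('a) + 1) = 2 * 2 powr (?N + 2 * s) * (2 ^ DIM('a) + 1) * R powr (2 * s)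
        / \<omega> * (1 - l) powr (2 * s)"
    using assms by (simp add: K_def \<rho>_def powr_mult)
  finally show ?thesis unfolding \<omega>_def .
qed

section \<open>The nonlinearity and integrability\<close>

text \<open>By the mean value theorem, since the derivative of the power is at least
  \<open>\<theta>\<close> beyond 1. It linearizes the volume factor in the Pohozaev
  inequality.\<close>

lemma Bernoulli_powr:
  fixes x \<theta> :: real
  assumes "1 \<le> x" "1 \<le> \<theta>"
  shows "\<theta> * (x - 1) \<le> x powr \<theta> - 1"
proof (cases "x = 1")
  case False
  then have "1 < x" using assms by simp
  have "\<exists>z. 1 < z \<and> z < x \<and> x powr \<theta> - 1 powr \<theta> = (x - 1) * (\<theta> * z powr (\<theta> - 1))"
    using \<open>1 < x\<close> by (intro MVT2) (auto intro!: has_real_derivative_powr)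
  then obtain z where z: "1 < z" "x powr \<theta> - 1 = (x - 1) * (\<theta> * z powr (\<theta> - 1))"
    by auto
  have "1 \<le> z powr (\<theta> - 1)"
    using z(1) assms by (simp add: ge_one_powr_ge_zero)
  then have "(x - 1) * (\<theta> * 1) \<le> (x - 1) * (\<theta> * z powr (\<theta> - 1))"
    using assms by (intro mult_left_mono) auto
  with z(2) show ?thesis by (simp add: mult.commute)
qed simp

text \<open>A one-sided Lipschitz bound by the mean value theorem. For z <= 1 the negative term of
  the derivative is dropped; for z > 1 the derivative is nonpositive because q > p, so heights above
  1 never enter the constant.\<close>

lemma reaction_diff_le:
  fixes p q x y m :: real
  assumes p: "1 < p" "p < q" and "0 < x" "x < y" "y \<le> m"
  shows "(y powr p - y powr q) - (x powr p - x powr q) \<le> p * min m 1 powr (p - 1) * (y - x)"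
proof -
  have "\<exists>z. x < z \<and> z < y \<and> (y powr p - y powr q) - (x powr p - x powr q)
      = (y - x) * (p * z powr (p - 1) - q * z powr (q - 1))"
    using assms by (intro MVT2) (auto intro!: derivative_eq_intros)
  then obtain z where z: "x < z" "z < y"
    and eq: "(y powr p - y powr q) - (x powr p - x powr q) = (y - x) * (p * z powr (p - 1) - q * z powr (q - 1))"
    by auto
  have "p * z powr (p - 1) - q * z powr (q - 1) \<le> p * min m 1 powr (p - 1)"
  proof (cases "z \<le> 1")
    case True
    then have "z powr (p - 1) \<le> min m 1 powr (p - 1)"
      using assms z by (intro powr_mono2) auto
    then have "p * z powr (p - 1) \<le> p * min m 1 powr (p - 1)"
      using p by (intro mult_left_mono) auto
    moreover have "0 \<le> q * z powr (q - 1)" using p by simp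
    ultimately show ?thesis by linarith
  next
    case False
    then have "z powr (p - 1) \<le> z powr (q - 1)"
      using p by (intro powr_mono) auto
    then have "p * z powr (p - 1) \<le> q * z powr (q - 1)"
      using p by (intro mult_mono) auto
    moreover have "0 \<le> p * min m 1 powr (p - 1)" using p by simp
    ultimately show ?thesis by linarith
  qed
  then show ?thesis unfolding eq using assms
    by (metis diff_gt_0_iff_gt mult.commute mult_le_cancel_left_pos)
qed

text \<open>
  Above the value \<open>1\<close> the nonlinearity \<open>x\<^sup>p - x\<^sup>q\<close> is decreasing, so that only the truncation of the
  solution at \<open>1\<close> enters the second order remainder; this replaces an a priori bound.
\<close>

lemma reaction_taylor_le:
  fixes p q a b :: real
  assumes p: "1 < p" "p < q" and "0 < a" "0 < b"
  shows "(b powr (p + 1) / (p + 1) - b powr (q + 1) / (q + 1))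
      - (a powr (p + 1) / (p + 1) - a powr (q + 1) / (q + 1)) - (a powr p - a powr q) * (b - a)
    \<le> p / 2 * (min (max a b) 1 powr (p - 1) * (b - a)\<^sup>2)"
proof -
  define K where "K = p * min (max a b) 1 powr (p - 1)"
  define f where "f x = x powr p - x powr q" for x :: real
  \<comment> \<open>The primitive minus its tangent at \<open>a\<close> and minus a parabola of
    curvature \<open>K\<close>. By the one-sided Lipschitz bound, between \<open>a\<close> and
    \<open>b\<close> its derivative is nonpositive to the right of \<open>a\<close> and nonnegative
    to the left, whence \<open>G b \<le> G a\<close>.\<close>
  define G where "G x = x powr (p + 1) / (p + 1) - x powr (q + 1) / (q + 1)
    - f a * (x - a) - K / 2 * (x - a)\<^sup>2" for x
  have G: "(G has_real_derivative f x - f a - K * (x - a)) (at x)" if "0 < x" for x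
    unfolding G_def f_def using that p by (auto intro!: derivative_eq_intros)
  have "G b \<le> G a"
  proof (cases a b rule: linorder_cases)
    case less
    have "\<exists>z. a < z \<and> z < b \<and> G b - G a = (b - a) * (f z - f a - K * (z - a))"
      using less \<open>0 < a\<close> by (intro MVT2 G) auto
    then obtain z where z: "a < z" "z < b" "G b - G a = (b - a) * (f z - f a - K * (z - a))"
      by auto
    have "f z - f a \<le> K * (z - a)"
      unfolding f_def K_def using z \<open>0 < a\<close> p by (intro reaction_diff_le) auto
    then have "(b - a) * (f z - f a - K * (z - a)) \<le> 0"
      using less by (intro mult_nonneg_nonpos) auto
    with z show ?thesis by linarith
  next
    case greater
    have "\<exists>z. b < z \<and> z < a \<and> G a - G b = (a - b) * (f z - f a - K * (z - a))"
      using greater \<open>0 < b\<close> by (intro MVT2 G) auto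
    then obtain z where z: "b < z" "z < a" "G a - G b = (a - b) * (f z - f a - K * (z - a))"
      by auto
    have "f a - f z \<le> K * (a - z)"
      unfolding f_def K_def using z \<open>0 < b\<close> p by (intro reaction_diff_le) auto
    then have "0 \<le> f z - f a - K * (z - a)" by (simp add: algebra_simps)
    then have "0 \<le> (a - b) * (f z - f a - K * (z - a))"
      using greater by (intro mult_nonneg_nonneg) auto
    with z show ?thesis by linarith
  qed simp
  moreover have "G a = a powr (p + 1) / (p + 1) - a powr (q + 1) / (q + 1)"
    by (simp add: G_def)
  moreover have "p / 2 * (min (max a b) 1 powr (p - 1) * (b - a)\<^sup>2) = K / 2 * (b - a)\<^sup>2"
    by (simp add: K_def)
  ultimately show ?thesis
    unfolding G_def[of b] f_def by linarith
qed

text \<open>Young's inequality for the exponents (p + 1) / (p - 1) and (p + 1) / 2 with a free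
  parameter, up to constants: \<open>v\<close> is compared with
  \<open>\<eta> * \<bar>w\<bar>\<close>, and whichever dominates replaces the other.\<close>

lemma powr_mult_power2_le:
  fixes v w p \<eta> :: real
  assumes "1 < p" "0 \<le> v" "0 < \<eta>"
  shows "v powr (p - 1) * w\<^sup>2 \<le> \<eta> powr (p - 1) * \<bar>w\<bar> powr (p + 1) + v powr (p + 1) / \<eta>\<^sup>2"
proof -
  have sq: "y powr (p - 1) * y\<^sup>2 = y powr (p + 1)" if "0 \<le> y" for y :: real
    using that powr_add[of y "p - 1" 2] by (cases "y = 0") (auto simp: add.commute)
  show ?thesis
  proof (cases "v \<le> \<eta> * \<bar>w\<bar>")
    case True
    then have "v powr (p - 1) \<le> (\<eta> * \<bar>w\<bar>) powr (p - 1)"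
      using assms by (intro powr_mono2) auto
    then have "v powr (p - 1) * w\<^sup>2 \<le> (\<eta> * \<bar>w\<bar>) powr (p - 1) * w\<^sup>2"
      by (intro mult_right_mono) auto
    also have "\<dots> = \<eta> powr (p - 1) * (\<bar>w\<bar> powr (p - 1) * \<bar>w\<bar>\<^sup>2)"
      by (simp add: powr_mult)
    also have "\<dots> = \<eta> powr (p - 1) * \<bar>w\<bar> powr (p + 1)"
      using sq[of "\<bar>w\<bar>"] by simp
    finally show ?thesis by (simp add: add_increasing2)
  next
    case False
    then have "\<bar>w\<bar> \<le> v / \<eta>"
      using assms by (simp add: pos_le_divide_eq mult.commute)
    then have "w\<^sup>2 \<le> (v / \<eta>)\<^sup>2"
      using power_mono[of "\<bar>w\<bar>" "v / \<eta>" 2] by simp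
    then have "v powr (p - 1) * w\<^sup>2 \<le> v powr (p - 1) * (v / \<eta>)\<^sup>2"
      by (intro mult_left_mono) auto
    also have "\<dots> = v powr (p - 1) * v\<^sup>2 / \<eta>\<^sup>2"
      by (simp add: power_divide)
    also have "\<dots> = v powr (p + 1) / \<eta>\<^sup>2"
      using sq[of v] assms by simp
    finally show ?thesis by (simp add: add_increasing)
  qed
qed

lemma integrable_powr_mult_power2:
  fixes v w :: "'a \<Rightarrow> real"
  assumes "1 < p" and [measurable]: "v \<in> borel_measurable M" "w \<in> borel_measurable M"
    and "integrable M (\<lambda>x. \<bar>v x\<bar> powr (p + 1))" "integrable M (\<lambda>x. \<bar>w x\<bar> powr (p + 1))"
  shows "integrable M (\<lambda>x. \<bar>v x\<bar> powr (p - 1) * (w x)\<^sup>2)"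
proof (rule Bochner_Integration.integrable_bound)
  show "integrable M (\<lambda>x. \<bar>w x\<bar> powr (p + 1) + \<bar>v x\<bar> powr (p + 1))"
    using assms by simp
  have "\<bar>v x\<bar> powr (p - 1) * (w x)\<^sup>2 \<le> \<bar>w x\<bar> powr (p + 1) + \<bar>v x\<bar> powr (p + 1)" for x
    using powr_mult_power2_le[OF \<open>1 < p\<close>, of "\<bar>v x\<bar>" 1 "w x"] by simp
  then show "AE x in M. norm (\<bar>v x\<bar> powr (p - 1) * (w x)\<^sup>2) \<le> norm (\<bar>w x\<bar> powr (p + 1) + \<bar>v x\<bar> powr (p + 1))"
    by simp
qed measurable

text \<open>A substitute for Hoelder's inequality with the exponents (p + 1) / (p - 1) and (p + 1) /
  2. Since \<open>\<delta>\<close> depends only on \<open>p\<close> and \<open>\<epsilon>\<close>,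
  it serves all dilations at once.\<close>

lemma small_potential:
  fixes p \<epsilon> :: real
  assumes "1 < p" "0 < \<epsilon>"
  obtains \<delta> where "0 < \<delta>" "\<And>(v :: 'a \<Rightarrow> real) w M. v \<in> borel_measurable M \<Longrightarrow> w \<in> borel_measurable M \<Longrightarrow>
    integrable M (\<lambda>x. \<bar>v x\<bar> powr (p + 1)) \<Longrightarrow> integrable M (\<lambda>x. \<bar>w x\<bar> powr (p + 1)) \<Longrightarrow>
    (\<integral>x. \<bar>v x\<bar> powr (p + 1) \<partial>M) \<le> \<delta> \<Longrightarrow>
    (\<integral>x. \<bar>v x\<bar> powr (p - 1) * (w x)\<^sup>2 \<partial>M) \<le> \<epsilon> * (\<integral>x. \<bar>w x\<bar> powr (p + 1) \<partial>M) powr (2 / (p + 1))"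
proof -
  define h where "h = (\<epsilon> / 2) powr (1 / (p - 1))"
  have "0 < h" and h: "h powr (p - 1) = \<epsilon> / 2"
    using assms by (auto simp: h_def powr_powr)
  define \<delta> where "\<delta> = h\<^sup>2 * (\<epsilon> / 2)"
  have "0 < \<delta>" using \<open>0 < h\<close> \<open>0 < \<epsilon>\<close> by (simp add: \<delta>_def)
  moreover have "(\<integral>x. \<bar>v x\<bar> powr (p - 1) * (w x)\<^sup>2 \<partial>M) \<le> \<epsilon> * (\<integral>x. \<bar>w x\<bar> powr (p + 1) \<partial>M) powr (2 / (p + 1))"
    if [measurable]: "v \<in> borel_measurable M" "w \<in> borel_measurable M"
      and v: "integrable M (\<lambda>x. \<bar>v x\<bar> powr (p + 1))" and w: "integrable M (\<lambda>x. \<bar>w x\<bar> powr (p + 1))"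
      and le: "(\<integral>x. \<bar>v x\<bar> powr (p + 1) \<partial>M) \<le> \<delta>" for v w :: "'a \<Rightarrow> real" and M
  proof -
    define I where "I = (\<integral>x. \<bar>w x\<bar> powr (p + 1) \<partial>M)"
    have "0 \<le> I" by (simp add: I_def)
    show ?thesis
    proof (cases "I = 0")
      \<comment> \<open>The choice of \<open>\<eta>\<close> below degenerates to 0 here, but then
        \<open>w\<close> vanishes almost everywhere.\<close>
      case True
      then have "AE x in M. \<bar>w x\<bar> powr (p + 1) = 0"
        using integral_nonneg_eq_0_iff_AE[OF w] by (simp add: I_def)
      then have "(\<integral>x. \<bar>v x\<bar> powr (p - 1) * (w x)\<^sup>2 \<partial>M) = (\<integral>x. 0 \<partial>M)"
        by (intro integral_cong_AE) auto
      then show ?thesis using \<open>0 < \<epsilon>\<close> by simp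
    next
      case False
      with \<open>0 \<le> I\<close> have "0 < I" by simp
      \<comment> \<open>Scaled with the norm of \<open>w\<close> so that, with
        \<open>\<delta>\<close> in place of the integral of \<open>v\<close>, both terms of Young's
        inequality become \<open>\<epsilon> / 2 * I powr (2 / (p + 1))\<close>.\<close>
      define \<eta> where "\<eta> = h * I powr (- 1 / (p + 1))"
      have "0 < \<eta>" using \<open>0 < h\<close> \<open>0 < I\<close> by (simp add: \<eta>_def)
      have "(\<integral>x. \<bar>v x\<bar> powr (p - 1) * (w x)\<^sup>2 \<partial>M)
          \<le> (\<integral>x. \<eta> powr (p - 1) * \<bar>w x\<bar> powr (p + 1) + \<bar>v x\<bar> powr (p + 1) / \<eta>\<^sup>2 \<partial>M)"
        using assms v w \<open>0 < \<eta>\<close>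
        by (intro integral_mono integrable_powr_mult_power2 powr_mult_power2_le) auto
      also have "\<dots> = \<eta> powr (p - 1) * I + (\<integral>x. \<bar>v x\<bar> powr (p + 1) \<partial>M) / \<eta>\<^sup>2"
        using v w by (simp add: I_def)
      also have "\<dots> \<le> \<eta> powr (p - 1) * I + \<delta> / \<eta>\<^sup>2"
        using le by (intro add_left_mono divide_right_mono) auto
      also have "\<eta> powr (p - 1) * I = \<epsilon> / 2 * I powr (2 / (p + 1))"
      proof -
        have "\<eta> powr (p - 1) = \<epsilon> / 2 * I powr (- 1 / (p + 1) * (p - 1))"
          unfolding \<eta>_def powr_mult powr_powr h ..
        moreover have "I powr (- 1 / (p + 1) * (p - 1)) * I powr 1 = I powr (2 / (p + 1))"
          using \<open>1 < p\<close> by (subst powr_add[symmetric]) (simp add: field_simps)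
        ultimately show ?thesis using \<open>0 < I\<close> 
          by (metis less_imp_le mult.assoc powr_one)
      qed
      also have "\<delta> / \<eta>\<^sup>2 = \<epsilon> / 2 * I powr (2 / (p + 1))"
      proof -
        have "(I powr (- 1 / (p + 1)))\<^sup>2 = I powr (- (2 / (p + 1)))"
          using \<open>0 < I\<close> by (simp add: powr_powr flip: powr_numeral)
        then have "\<eta>\<^sup>2 = h\<^sup>2 * I powr (- (2 / (p + 1)))"
          by (simp only: \<eta>_def power_mult_distrib)
        then have "\<eta>\<^sup>2 = h\<^sup>2 / I powr (2 / (p + 1))"
          by (simp add: powr_minus_divide)
        then show ?thesis using \<open>0 < h\<close> \<open>0 < I\<close> by (simp add: \<delta>_def)
      qed
      finally show ?thesis by (simp add: I_def)
    qed
  qed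
  ultimately show thesis by (rule that)
qed

section \<open>Integrability, globally and on balls, and smallness at infinity\<close>

lemma powr_mult_abs_le:
  fixes x y p :: real
  assumes "0 < p"
  shows "\<bar>x\<bar> powr p * \<bar>y\<bar> \<le> \<bar>x\<bar> powr (p + 1) + \<bar>y\<bar> powr (p + 1)"
proof (cases "\<bar>y\<bar> \<le> \<bar>x\<bar>")
  case True
  then have "\<bar>x\<bar> powr p * \<bar>y\<bar> \<le> \<bar>x\<bar> powr p * \<bar>x\<bar>"
    by (intro mult_left_mono) auto
  also have "\<dots> = \<bar>x\<bar> powr (p + 1)"
    using powr_add[of "\<bar>x\<bar>" p 1] by (cases "x = 0") auto
  finally show ?thesis by (simp add: add_increasing2)
next
  case False
  then have "\<bar>x\<bar> powr p * \<bar>y\<bar> \<le> \<bar>y\<bar> powr p * \<bar>y\<bar>"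
    using assms by (intro mult_right_mono powr_mono2) auto
  also have "\<dots> = \<bar>y\<bar> powr (p + 1)"
    using powr_add[of "\<bar>y\<bar>" p 1] by (cases "y = 0") auto
  finally show ?thesis by (simp add: add_increasing)
qed

lemma Lp_space_diff:
  assumes u: "u \<in> Lp_space r" and v: "v \<in> Lp_space r" and "0 < r"
  shows "(\<lambda>x. v x - u x) \<in> Lp_space r"
proof -
  have [measurable]: "u \<in> borel_measurable borel" "v \<in> borel_measurable borel"
    using u v by (auto simp: Lp_space_def)
  have le: "\<bar>b - a\<bar> powr r \<le> 2 powr r * (\<bar>a\<bar> powr r + \<bar>b\<bar> powr r)" for a b :: real
  proof -
    have "\<bar>b - a\<bar> powr r \<le> (2 * max \<bar>a\<bar> \<bar>b\<bar>) powr r"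
      using \<open>0 < r\<close> by (intro powr_mono2) auto
    also have "\<dots> = 2 powr r * max \<bar>a\<bar> \<bar>b\<bar> powr r"
      by (simp add: powr_mult)
    also have "\<dots> \<le> 2 powr r * (\<bar>a\<bar> powr r + \<bar>b\<bar> powr r)"
      by (intro mult_left_mono) (auto simp: max_def)
    finally show ?thesis .
  qed
  have "integrable lborel (\<lambda>x. \<bar>v x - u x\<bar> powr r)"
  proof (rule Bochner_Integration.integrable_bound)
    show "integrable lborel (\<lambda>x. 2 powr r * (\<bar>u x\<bar> powr r + \<bar>v x\<bar> powr r))"
      using u v by (simp add: Lp_space_def)
    show "AE x in lborel. norm (\<bar>v x - u x\<bar> powr r) \<le> norm (2 powr r * (\<bar>u x\<bar> powr r + \<bar>v x\<bar> powr r))"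
      using le by (simp add: abs_mult)
  qed measurable
  then show ?thesis by (simp add: Lp_space_def)
qed

text \<open>Here y^2 <= 1 + |y|^r, and the constant 1 is integrable on a ball. This makes the local
  L^2 integrals of the increments genuine.\<close>

lemma integrable_ball_power2:
  fixes w :: "'a::euclidean_space \<Rightarrow> real"
  assumes [measurable]: "w \<in> borel_measurable borel"
    and w: "integrable lborel (\<lambda>x. \<bar>w x\<bar> powr r)" and "2 \<le> r"
  shows "integrable lborel (\<lambda>x. indicator (ball 0 R) x * (w x)\<^sup>2)"
proof (rule Bochner_Integration.integrable_bound)
  show "integrable lborel (\<lambda>x. indicator (ball 0 R) x + \<bar>w x\<bar> powr r)"
    using w emeasure_bounded_finite[OF bounded_ball, of 0 R]
    by (intro Bochner_Integration.integrable_add integrable_real_indicator) auto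
  have "y\<^sup>2 \<le> 1 + \<bar>y\<bar> powr r" for y :: real
  proof (cases "\<bar>y\<bar> \<le> 1")
    case True
    then have "y\<^sup>2 \<le> 1" by (simp add: abs_square_le_1)
    then show ?thesis by (simp add: add_increasing2)
  next
    case False
    then have "\<bar>y\<bar> powr 2 \<le> \<bar>y\<bar> powr r"
      using \<open>2 \<le> r\<close> by (intro powr_mono) auto
    with False show ?thesis by simp
  qed
  then show "AE x in lborel. norm (indicator (ball 0 R) x * (w x)\<^sup>2) \<le> norm (indicator (ball 0 R) x + \<bar>w x\<bar> powr r)"
    by (auto simp: indicator_def)
qed measurable

lemma integral_outside_ball_small:
  fixes f :: "'a::euclidean_space \<Rightarrow> real"
  assumes f: "integrable lborel f" and "0 < d"
  obtains R where "0 < R" "(\<integral>x. indicator (- ball 0 R) x * f x \<partial>lborel) < d"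
proof -
  have [measurable]: "f \<in> borel_measurable borel"
    using f by auto
  have "(\<lambda>n. \<integral>x. indicator (- ball 0 (real n)) x * f x \<partial>lborel) \<longlonglongrightarrow> (\<integral>x. 0 \<partial>(lborel :: 'a measure))"
  proof (rule integral_dominated_convergence[where w="\<lambda>x. \<bar>f x\<bar>"])
    show "AE x in lborel. (\<lambda>n. indicator (- ball 0 (real n)) x * f x) \<longlonglongrightarrow> 0"
    proof (rule AE_I2)
      fix x :: 'a
      have "eventually (\<lambda>n. indicator (- ball 0 (real n)) x * f x = 0) sequentially"
        using eventually_gt_at_top[of "nat \<lceil>norm x\<rceil>"]
        by eventually_elim (simp add: indicator_def, linarith)
      then show "(\<lambda>n. indicator (- ball 0 (real n)) x * f x) \<longlonglongrightarrow> 0"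
        by (rule tendsto_eventually)
    qed
    show "integrable lborel (\<lambda>x. \<bar>f x\<bar>)" using f by simp
    show "AE x in lborel. norm (indicator (- ball 0 (real n)) x * f x) \<le> \<bar>f x\<bar>" for n
      by (simp add: indicator_def)
  qed measurable
  then have "eventually (\<lambda>n. (\<integral>x. indicator (- ball 0 (real n)) x * f x \<partial>lborel) < d) sequentially"
    using \<open>0 < d\<close> by (intro order_tendstoD) auto
  then have "eventually (\<lambda>n. (\<integral>x. indicator (- ball 0 (real n)) x * f x \<partial>lborel) < d \<and> 0 < n) sequentially"
    using eventually_gt_at_top[of 0] by eventually_elim auto
  then obtain n where "(\<integral>x. indicator (- ball 0 (real n)) x * f x \<partial>lborel) < d" "0 < n"
    by (auto dest: eventually_happens)
  with that[of "real n"] show thesis by simp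
qed

text \<open>The halving estimate makes \<open>E\<close> decay faster than linearly along \<open>t\<^sub>0 / 2\<^sup>n\<close>.\<close>

lemma halving_contradiction:
  fixes E :: "real \<Rightarrow> real"
  assumes "0 < c" "0 < t\<^sub>0"
    and lower: "\<And>t. 0 < t \<Longrightarrow> t \<le> t\<^sub>0 \<Longrightarrow> c * t \<le> E t"
    and halve: "\<And>t. 0 < t \<Longrightarrow> 2 * t \<le> t\<^sub>0 \<Longrightarrow> E t \<le> 5 / 12 * E (2 * t)"
  shows False
proof -
  have E: "E (t\<^sub>0 / 2 ^ n) \<le> (5 / 12) ^ n * E t\<^sub>0" for n
  proof (induction n)
    case (Suc n)
    have "1 \<le> (2 :: real) ^ n" by simp
    then have "t\<^sub>0 / 2 ^ n \<le> t\<^sub>0" using \<open>0 < t\<^sub>0\<close> by (simp add: field_simps)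
    then have "E (t\<^sub>0 / 2 ^ Suc n) \<le> 5 / 12 * E (t\<^sub>0 / 2 ^ n)"
      using halve[of "t\<^sub>0 / 2 ^ Suc n"] \<open>0 < t\<^sub>0\<close> by simp
    also have "\<dots> \<le> 5 / 12 * ((5 / 12) ^ n * E t\<^sub>0)"
      using Suc by (intro mult_left_mono) auto
    finally show ?case by simp
  qed simp
  have "c * t\<^sub>0 \<le> (5 / 6) ^ n * E t\<^sub>0" for n
  proof -
    have "1 \<le> (2 :: real) ^ n" by simp
    then have "c * (t\<^sub>0 / 2 ^ n) \<le> E (t\<^sub>0 / 2 ^ n)"
      using \<open>0 < t\<^sub>0\<close> by (intro lower) (auto simp: field_simps)
    with E[of n] have "c * (t\<^sub>0 / 2 ^ n) \<le> (5 / 12) ^ n * E t\<^sub>0" by linarith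
    then have "2 ^ n * (c * (t\<^sub>0 / 2 ^ n)) \<le> 2 ^ n * ((5 / 12) ^ n * E t\<^sub>0)"
      by (intro mult_left_mono) auto
    \<comment> \<open>The factor 5 / 12 is below 1 / 2, so the bound still tends to 0 after
      multiplication by 2^n.\<close>
    moreover have "2 ^ n * (5 / 12) ^ n = (5 / 6 :: real) ^ n"
      by (simp flip: power_mult_distrib)
    ultimately show ?thesis by (simp flip: mult.assoc)
  qed
  moreover have "(\<lambda>n. (5 / 6) ^ n * E t\<^sub>0) \<longlonglongrightarrow> 0"
    by (intro tendsto_mult_left_zero LIMSEQ_power_zero) simp
  ultimately have "c * t\<^sub>0 \<le> 0"
    by (intro LIMSEQ_le_const) auto
  with assms show False by (simp add: mult_le_0_iff)
qed

section \<open>The Gagliardo form\<close>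

text \<open>The pointwise bound |ab| <= a^2 + b^2 dominates the mixed integrand, so the form can be
  expanded bilinearly.\<close>

lemma integrable_gagliardo_integrand:
  fixes u v :: "real ^ 'n \<Rightarrow> real"
  assumes [measurable]: "u \<in> borel_measurable borel" "v \<in> borel_measurable borel"
    and "finite_energy s u" "finite_energy s v"
  shows "integrable (lborel \<Otimes>\<^sub>M lborel) (gagliardo_integrand s u v)"
proof (rule Bochner_Integration.integrable_bound)
  show "integrable (lborel \<Otimes>\<^sub>M lborel) (\<lambda>z. gagliardo_integrand s u u z + gagliardo_integrand s v v z)"
    using assms by (simp add: finite_energy_def)
  show "gagliardo_integrand s u v \<in> borel_measurable (lborel \<Otimes>\<^sub>M lborel)"
    unfolding lborel_prod by simp
  have "\<bar>a * b\<bar> / d \<le> (a * a) / d + (b * b) / d" if "0 \<le> d" for a b d :: real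
  proof -
    have "2 * (\<bar>a\<bar> * \<bar>b\<bar>) \<le> a * a + b * b"
      using sum_squares_bound[of "\<bar>a\<bar>" "\<bar>b\<bar>"] by (simp add: power2_eq_square)
    moreover have "0 \<le> \<bar>a\<bar> * \<bar>b\<bar>" by simp
    ultimately have "\<bar>a * b\<bar> \<le> a * a + b * b"
      unfolding abs_mult by linarith
    then show ?thesis using that by (simp add: divide_right_mono flip: add_divide_distrib)
  qed
  then show "AE z in lborel \<Otimes>\<^sub>M lborel. norm (gagliardo_integrand s u v z)
      \<le> norm (gagliardo_integrand s u u z + gagliardo_integrand s v v z)"
    by (auto simp: gagliardo_integrand_def split_beta abs_of_nonneg add_nonneg_nonneg)
qed

lemma gagliardo_integrand_diff:
  "gagliardo_integrand s (\<lambda>x. v x - u x) (\<lambda>x. v x - u x)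
    = (\<lambda>z. gagliardo_integrand s v v z - 2 * gagliardo_integrand s u v z + gagliardo_integrand s u u z)"
  by (auto simp: fun_eq_iff gagliardo_integrand_def algebra_simps simp flip: add_divide_distrib diff_divide_distrib)

lemma finite_energy_diff:
  fixes u v :: "real ^ 'n \<Rightarrow> real"
  assumes "u \<in> borel_measurable borel" "v \<in> borel_measurable borel"
    and "finite_energy s u" "finite_energy s v"
  shows "finite_energy s (\<lambda>x. v x - u x)"
  using integrable_gagliardo_integrand[OF assms] assms
  by (simp add: finite_energy_def gagliardo_integrand_diff)

lemma gagliardo_form_diff:
  fixes u v :: "real ^ 'n \<Rightarrow> real"
  assumes "u \<in> borel_measurable borel" "v \<in> borel_measurable borel"
    and "finite_energy s u" "finite_energy s v"
  shows "gagliardo_form s (\<lambda>x. v x - u x) (\<lambda>x. v x - u x)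
    = gagliardo_form s v v - 2 * gagliardo_form s u v + gagliardo_form s u u"
  using integrable_gagliardo_integrand[OF assms] assms
  by (simp add: finite_energy_def gagliardo_form_def gagliardo_integrand_diff algebra_simps)

lemma nn_integral_gagliardo_density:
  fixes w :: "real ^ 'n \<Rightarrow> real"
  assumes [measurable]: "w \<in> borel_measurable borel" and w: "finite_energy s w"
  shows "(\<integral>\<^sup>+x. gagliardo_density s w x \<partial>lborel)
    = ennreal (\<integral>z. gagliardo_integrand s w w z \<partial>(lborel \<Otimes>\<^sub>M lborel))"
proof -
  have "(\<integral>\<^sup>+x. gagliardo_density s w x \<partial>lborel)
      = (\<integral>\<^sup>+x. \<integral>\<^sup>+y. ennreal (gagliardo_integrand s w w (x, y)) \<partial>lborel \<partial>lborel)"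
    by (simp add: gagliardo_density_def gagliardo_integrand_def power2_eq_square)
  also have "\<dots> = (\<integral>\<^sup>+z. ennreal (gagliardo_integrand s w w z) \<partial>(lborel \<Otimes>\<^sub>M lborel))"
  proof (rule lborel.nn_integral_fst)
    show "(\<lambda>z. ennreal (gagliardo_integrand s w w z)) \<in> borel_measurable (lborel \<Otimes>\<^sub>M lborel)"
      unfolding lborel_prod by simp
  qed
  also have "\<dots> = ennreal (\<integral>z. gagliardo_integrand s w w z \<partial>(lborel \<Otimes>\<^sub>M lborel))"
    using w by (intro nn_integral_eq_integral)
      (auto simp: finite_energy_def gagliardo_integrand_def)
  finally show ?thesis .
qed

section \<open>The Pohozaev inequality for dilations\<close>

text \<open>A context to be shown inconsistent: a solution is assumed throughout and refuted at the
  end.\<close>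

locale supercritical_solution =
  fixes s p q :: real and u :: "real ^ 'n \<Rightarrow> real"
  assumes s: "0 < s" "s < 1" "2 * s < real CARD('n)"
    and p: "p = crit_exp CARD('n) s - 1" and pq: "p < q"
    and sol: "weak_solution s p q u"
begin

abbreviation "P \<equiv> \<integral>x. u x powr (p + 1) \<partial>lborel"
abbreviation "Q \<equiv> \<integral>x. u x powr (q + 1) \<partial>lborel"

definition incr :: "real \<Rightarrow> real ^ 'n \<Rightarrow> real" where
  "incr l x = u (l *\<^sub>R x) - u x"

text \<open>Normalized without \<open>frac_const\<close>, so that it matches the integral of
  \<open>gagliardo_density\<close>.\<close>

definition energy :: "real \<Rightarrow> real" where
  "energy l = (\<integral>z. gagliardo_integrand s (incr l) (incr l) z \<partial>(lborel \<Otimes>\<^sub>M lborel))"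

text \<open>The factor from \<open>reaction_taylor_le\<close>; the absolute values cover the null
  sets on which \<open>u\<close> or its dilation fails to be positive.\<close>

definition weight :: "real \<Rightarrow> real ^ 'n \<Rightarrow> real" where
  "weight l x = min (max \<bar>u x\<bar> \<bar>u (l *\<^sub>R x)\<bar>) 1 powr (p - 1)"

text \<open>What remains of (p + 1) / 2 * (P / (p + 1) - Q / (q + 1)) after subtracting (P - Q) / 2:
  the defect in the Pohozaev identity.\<close>

definition gap :: real where
  "gap = Q * ((p + 1) / 2 * (1 / (p + 1) - 1 / (q + 1)))"

section \<open>Elementary properties of the solution, its dilations and its increments\<close>

lemma crit_exp_eq: "crit_exp CARD('n) s = p + 1"
  by (simp add: p)

lemma p_eq: "p + 1 = 2 * real CARD('n) / (real CARD('n) - 2 * s)"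
  by (simp add: p crit_exp_def)

lemma p_gt_1: "1 < p"
proof -
  have "2 < p + 1" unfolding p_eq using s by (simp add: field_simps)
  then show ?thesis by simp
qed

lemma u_Hdot: "u \<in> Hdot s"
  and u_Lq: "u \<in> Lp_space (q + 1)"
  and u_pos: "AE x in lborel. 0 < u x"
  using sol by (auto simp: weak_solution_def)

lemma u_Lp: "u \<in> Lp_space (p + 1)" and u_energy: "finite_energy s u"
  using u_Hdot by (auto simp: Hdot_def crit_exp_eq)

lemma u_measurable [measurable]: "u \<in> borel_measurable borel"
  using u_Lp by (simp add: Lp_space_def)

lemma integrable_u: "integrable lborel (\<lambda>x. u x powr (p + 1))" "integrable lborel (\<lambda>x. u x powr (q + 1))"
proof -
  have "integrable lborel (\<lambda>x. u x powr r)" if "u \<in> Lp_space r" for r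
  proof -
    have "integrable lborel (\<lambda>x. \<bar>u x\<bar> powr r)" using that by (simp add: Lp_space_def)
    then show ?thesis
      using u_pos by (subst integrable_cong_AE[where g="\<lambda>x. \<bar>u x\<bar> powr r"]) auto
  qed
  then show "integrable lborel (\<lambda>x. u x powr (p + 1))" "integrable lborel (\<lambda>x. u x powr (q + 1))"
    using u_Lp u_Lq by auto
qed

lemma Q_pos: "0 < Q"
proof -
  have "0 \<le> Q" by simp
  moreover have "Q \<noteq> 0"
  proof
    assume "Q = 0"
    then have "AE x in lborel. u x powr (q + 1) = 0"
      using integral_nonneg_eq_0_iff_AE[OF integrable_u(2)] by simp
    with u_pos have "AE x in (lborel :: (real ^ 'n) measure). False"
      by eventually_elim auto
    then show False
      using AE_iff_measurable[of UNIV lborel "\<lambda>_ :: real ^ 'n. False"] by simp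
  qed
  ultimately show ?thesis by linarith
qed

lemma gap_pos: "0 < gap"
proof -
  have "1 / (q + 1) < 1 / (p + 1)"
    using p_gt_1 pq by (intro divide_strict_left_mono) auto
  then show ?thesis
    using Q_pos p_gt_1 unfolding gap_def by (intro mult_pos_pos) auto
qed

lemma dilation_Hdot: "0 < l \<Longrightarrow> (\<lambda>x. u (l *\<^sub>R x)) \<in> Hdot s"
  using u_Hdot s by (intro Hdot_dilation)

lemma dilation_pos: "0 < l \<Longrightarrow> AE x in lborel. 0 < u (l *\<^sub>R x)"
  by (intro AE_dilation[where P="\<lambda>x. 0 < u x"] u_pos) auto

lemma incr_measurable [measurable]: "incr l \<in> borel_measurable borel"
  unfolding incr_def[abs_def] by measurable

lemma weight_measurable [measurable]: "weight l \<in> borel_measurable borel"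
  unfolding weight_def[abs_def] by measurable

lemma incr_Lp: "0 < l \<Longrightarrow> incr l \<in> Lp_space (p + 1)"
  unfolding incr_def[abs_def] using u_Lp p_gt_1 by (intro Lp_space_diff Lp_space_dilation) auto

lemma incr_integrable: "0 < l \<Longrightarrow> integrable lborel (\<lambda>x. \<bar>incr l x\<bar> powr (p + 1))"
  using incr_Lp by (simp add: Lp_space_def)

lemma incr_energy: "0 < l \<Longrightarrow> finite_energy s (incr l)"
  unfolding incr_def[abs_def] using u_energy
  by (intro finite_energy_diff finite_energy_dilation) auto

lemma gagliardo_form_incr: "gagliardo_form s (incr l) (incr l) = frac_const CARD('n) s / 2 * energy l"
  by (simp add: gagliardo_form_def energy_def)

lemma energy_nonneg: "0 \<le> energy l"
  unfolding energy_def by (intro integral_nonneg_AE) (auto simp: gagliardo_integrand_def)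

lemma nn_integral_incr_density:
  "0 < l \<Longrightarrow> (\<integral>\<^sup>+x. gagliardo_density s (incr l) x \<partial>lborel) = ennreal (energy l)"
  unfolding energy_def by (intro nn_integral_gagliardo_density incr_energy) auto

text \<open>Integrability against the power \<open>q\<close> is part of being a solution; against
  the power \<open>p\<close> it follows because \<open>u\<close> and \<open>\<phi>\<close> both lie
  in L^(p+1).\<close>

lemma weak_formulation:
  assumes "\<phi> \<in> Hdot s"
  shows "integrable lborel (\<lambda>x. u x powr q * \<phi> x)" "integrable lborel (\<lambda>x. u x powr p * \<phi> x)"
    "gagliardo_form s u \<phi> = (\<integral>x. u x powr p * \<phi> x \<partial>lborel) - (\<integral>x. u x powr q * \<phi> x \<partial>lborel)"
proof -
  have \<phi>: "\<phi> \<in> Lp_space (p + 1)"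
    using assms by (simp add: Hdot_def crit_exp_eq)
  then have [measurable]: "\<phi> \<in> borel_measurable borel" by (simp add: Lp_space_def)
  show "integrable lborel (\<lambda>x. u x powr p * \<phi> x)"
  proof (rule Bochner_Integration.integrable_bound)
    show "integrable lborel (\<lambda>x. \<bar>u x\<bar> powr (p + 1) + \<bar>\<phi> x\<bar> powr (p + 1))"
      using \<phi> u_Lp by (simp add: Lp_space_def)
    show "AE x in lborel. norm (u x powr p * \<phi> x) \<le> norm (\<bar>u x\<bar> powr (p + 1) + \<bar>\<phi> x\<bar> powr (p + 1))"
      using u_pos
    proof eventually_elim
      case (elim x)
      then show ?case
        using powr_mult_abs_le[of p "u x" "\<phi> x"] p_gt_1 by (simp add: abs_mult)
    qed
  qed measurable
qed (use sol assms in \<open>auto simp: weak_solution_def\<close>)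

text \<open>The equation tested with the solution itself; in particular \<open>P - Q\<close> is
  nonnegative.\<close>

lemma gagliardo_form_u: "gagliardo_form s u u = P - Q"
proof -
  have "(\<integral>x. u x powr r * u x \<partial>lborel) = (\<integral>x. u x powr (r + 1) \<partial>lborel)" for r
    using u_pos by (intro integral_cong_AE) (auto simp: powr_add)
  then show ?thesis using weak_formulation(3)[OF u_Hdot] by simp
qed

text \<open>The first order Taylor remainder of the primitive of the nonlinearity, from
  \<open>u\<close> to its dilation. A change of variables evaluates the primitives, and the weak
  equation tested with \<open>u\<close> and with its dilation turns the linear term into a
  difference of forms.\<close>

lemma remainder_eq:
  assumes "0 < l"
  shows "integrable lborel (\<lambda>x.
        (u (l *\<^sub>R x) powr (p + 1) / (p + 1) - u (l *\<^sub>R x) powr (q + 1) / (q + 1))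
      - (u x powr (p + 1) / (p + 1) - u x powr (q + 1) / (q + 1))
      - (u x powr p - u x powr q) * (u (l *\<^sub>R x) - u x))" (is "integrable _ ?T")
    and "(\<integral>x.
        (u (l *\<^sub>R x) powr (p + 1) / (p + 1) - u (l *\<^sub>R x) powr (q + 1) / (q + 1))
      - (u x powr (p + 1) / (p + 1) - u x powr (q + 1) / (q + 1))
      - (u x powr p - u x powr q) * (u (l *\<^sub>R x) - u x) \<partial>lborel)
      = (1 / l ^ CARD('n) - 1) * (P / (p + 1) - Q / (q + 1))
        - (gagliardo_form s u (\<lambda>x. u (l *\<^sub>R x)) - gagliardo_form s u u)"
proof -
  note weak = weak_formulation[OF u_Hdot] weak_formulation[OF dilation_Hdot[OF assms]]
  have dil: "integrable lborel (\<lambda>x. u (l *\<^sub>R x) powr r)"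
    "(\<integral>x. u (l *\<^sub>R x) powr r \<partial>lborel) = (\<integral>x. u x powr r \<partial>lborel) / l ^ CARD('n)"
    if "integrable lborel (\<lambda>x. u x powr r)" for r
    using integrable_dilation[OF that, of l] integral_dilation[of "\<lambda>x. u x powr r" l] assms by auto
  note int = dil(1)[OF integrable_u(1)] dil(1)[OF integrable_u(2)] integrable_u weak(1,2,4,5)
  have T: "?T = (\<lambda>x. (u (l *\<^sub>R x) powr (p + 1) / (p + 1) - u (l *\<^sub>R x) powr (q + 1) / (q + 1))
      - (u x powr (p + 1) / (p + 1) - u x powr (q + 1) / (q + 1))
      - ((u x powr p * u (l *\<^sub>R x) - u x powr q * u (l *\<^sub>R x))
        - (u x powr p * u x - u x powr q * u x)))"
    by (simp add: algebra_simps)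
  show "integrable lborel ?T"
    unfolding T using int by (intro Bochner_Integration.integrable_diff integrable_divide) auto
  show "integral\<^sup>L lborel ?T = (1 / l ^ CARD('n) - 1) * (P / (p + 1) - Q / (q + 1))
        - (gagliardo_form s u (\<lambda>x. u (l *\<^sub>R x)) - gagliardo_form s u u)"
    unfolding T weak(3,6) using int dil(2)[OF integrable_u(1)] dil(2)[OF integrable_u(2)]
    by (simp add: left_diff_distrib right_diff_distrib diff_divide_distrib)
qed

text \<open>Expand the form of the increment as a square; the dilated form is a multiple of that of
  \<open>u\<close>, which is \<open>P - Q\<close>.\<close>

lemma incr_form_eq:
  assumes "0 < l"
  shows "gagliardo_form s u (\<lambda>x. u (l *\<^sub>R x)) - gagliardo_form s u u
    = (l powr (2 * s - real CARD('n)) - 1) * (P - Q) / 2 - frac_const CARD('n) s / 4 * energy l"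
proof -
  have "gagliardo_form s (incr l) (incr l) = gagliardo_form s (\<lambda>x. u (l *\<^sub>R x)) (\<lambda>x. u (l *\<^sub>R x))
      - 2 * gagliardo_form s u (\<lambda>x. u (l *\<^sub>R x)) + gagliardo_form s u u"
    unfolding incr_def[abs_def] using u_energy assms
    by (intro gagliardo_form_diff finite_energy_dilation) auto
  moreover have "gagliardo_form s (\<lambda>x. u (l *\<^sub>R x)) (\<lambda>x. u (l *\<^sub>R x)) = l powr (2 * s - real CARD('n)) * gagliardo_form s u u"
    using assms by (intro gagliardo_form_dilation) auto
  ultimately show ?thesis
    unfolding gagliardo_form_u gagliardo_form_incr by (simp add: field_simps)
qed

lemma weight_incr_integrable:
  assumes "0 < l"
  shows "integrable lborel (\<lambda>x. weight l x * (incr l x)\<^sup>2)"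
proof (rule Bochner_Integration.integrable_bound)
  have u: "integrable lborel (\<lambda>x. \<bar>u x\<bar> powr (p + 1))"
    using u_Lp by (simp add: Lp_space_def)
  show "integrable lborel (\<lambda>x. \<bar>u x\<bar> powr (p - 1) * (incr l x)\<^sup>2 + \<bar>u (l *\<^sub>R x)\<bar> powr (p - 1) * (incr l x)\<^sup>2)"
    using u integrable_dilation[OF u, of l] p_gt_1 incr_integrable assms
    by (intro Bochner_Integration.integrable_add integrable_powr_mult_power2) auto
  have "weight l x \<le> \<bar>u x\<bar> powr (p - 1) + \<bar>u (l *\<^sub>R x)\<bar> powr (p - 1)" for x
  proof -
    have "weight l x \<le> max \<bar>u x\<bar> \<bar>u (l *\<^sub>R x)\<bar> powr (p - 1)"
      unfolding weight_def using p_gt_1 by (intro powr_mono2) auto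
    also have "\<dots> \<le> \<bar>u x\<bar> powr (p - 1) + \<bar>u (l *\<^sub>R x)\<bar> powr (p - 1)"
      by (auto simp: max_def)
    finally show ?thesis .
  qed
  then have "weight l x * (incr l x)\<^sup>2 \<le> (\<bar>u x\<bar> powr (p - 1) + \<bar>u (l *\<^sub>R x)\<bar> powr (p - 1)) * (incr l x)\<^sup>2" for x
    by (intro mult_right_mono) auto
  then show "AE x in lborel. norm (weight l x * (incr l x)\<^sup>2)
      \<le> norm (\<bar>u x\<bar> powr (p - 1) * (incr l x)\<^sup>2 + \<bar>u (l *\<^sub>R x)\<bar> powr (p - 1) * (incr l x)\<^sup>2)"
    by (simp add: distrib_right weight_def)
qed measurable

text \<open>The form scales by \<open>\<mu>\<close> and the volume by
  \<open>\<mu> powr ((p + 1) / 2)\<close>, because \<open>p\<close> is critical. Bernoulli's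
  inequality compares the two factors, q > p leaves the surplus \<open>gap\<close>, and the
  pointwise Taylor estimate bounds the remainder from above.\<close>

lemma pohozaev_inequality:
  assumes "0 < l" "l < 1"
  shows "gap * (l powr (2 * s - real CARD('n)) - 1) + frac_const CARD('n) s / 4 * energy l
    \<le> p / 2 * (\<integral>x. weight l x * (incr l x)\<^sup>2 \<partial>lborel)"
proof -
  define \<mu> where "\<mu> = l powr (2 * s - real CARD('n))"
  define X where "X = P / (p + 1) - Q / (q + 1)"
  have "1 \<le> \<mu>"
    using assms s powr_mono'[of "2 * s - real CARD('n)" 0 l] by (simp add: \<mu>_def)
  have "\<mu> powr ((p + 1) / 2) = 1 / l ^ CARD('n)"
  proof -
    have "(2 * s - real CARD('n)) * ((p + 1) / 2) = - real CARD('n)"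
      unfolding p_eq using s by (simp add: field_simps)
    then have "\<mu> powr ((p + 1) / 2) = l powr (- real CARD('n))"
      by (simp add: \<mu>_def powr_powr)
    then show ?thesis
      using assms by (simp add: powr_minus_divide powr_realpow)
  qed
  with Bernoulli_powr[OF \<open>1 \<le> \<mu>\<close>, of "(p + 1) / 2"] p_gt_1
  have vol: "(p + 1) / 2 * (\<mu> - 1) \<le> 1 / l ^ CARD('n) - 1" by simp
  have "0 \<le> P - Q"
    using gagliardo_form_nonneg[of s u] s gagliardo_form_u by simp
  have X: "X = (P - Q) / (p + 1) + Q * (1 / (p + 1) - 1 / (q + 1))"
    by (simp add: X_def algebra_simps diff_divide_distrib)
  \<comment> \<open>The sign of \<open>X\<close> is what allows the Bernoulli bound
    \<open>vol\<close> to be multiplied by it.\<close>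
  have "0 \<le> Q * (1 / (p + 1) - 1 / (q + 1))"
    using Q_pos p_gt_1 pq by (intro mult_nonneg_nonneg) (auto intro!: divide_left_mono)
  then have "0 \<le> X"
    unfolding X using \<open>0 \<le> P - Q\<close> p_gt_1 by (intro add_nonneg_nonneg divide_nonneg_nonneg) auto
  have "gap * (\<mu> - 1) = (p + 1) / 2 * (\<mu> - 1) * X - (\<mu> - 1) * (P - Q) / 2"
  proof -
    have "(p + 1) / 2 * ((P - Q) / (p + 1)) = (P - Q) / 2"
      using p_gt_1 by (simp add: field_simps)
    then have "(p + 1) / 2 * X = (P - Q) / 2 + gap"
      unfolding X gap_def distrib_left by (simp only: mult_ac)
    then have "gap = (p + 1) / 2 * X - (P - Q) / 2"
      by (simp only: add_diff_cancel_left')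
    then have "gap * (\<mu> - 1) = ((p + 1) / 2 * X - (P - Q) / 2) * (\<mu> - 1)"
      by (rule arg_cong)
    then show ?thesis
      unfolding left_diff_distrib[of "(p + 1) / 2 * X"] by (simp only: times_divide_eq_left mult_ac)
  qed
  also have "\<dots> \<le> (1 / l ^ CARD('n) - 1) * X - (\<mu> - 1) * (P - Q) / 2"
    using mult_right_mono[OF vol \<open>0 \<le> X\<close>] by simp
  finally have "gap * (\<mu> - 1) + frac_const CARD('n) s / 4 * energy l
      \<le> (1 / l ^ CARD('n) - 1) * X - ((\<mu> - 1) * (P - Q) / 2 - frac_const CARD('n) s / 4 * energy l)"
    by simp
  also have "\<dots> = (\<integral>x.
        (u (l *\<^sub>R x) powr (p + 1) / (p + 1) - u (l *\<^sub>R x) powr (q + 1) / (q + 1))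
      - (u x powr (p + 1) / (p + 1) - u x powr (q + 1) / (q + 1))
      - (u x powr p - u x powr q) * (u (l *\<^sub>R x) - u x) \<partial>lborel)"
    unfolding remainder_eq(2)[OF \<open>0 < l\<close>] incr_form_eq[OF \<open>0 < l\<close>] X_def \<mu>_def by simp
  also have "\<dots> \<le> (\<integral>x. p / 2 * (weight l x * (incr l x)\<^sup>2) \<partial>lborel)"
  proof (rule integral_mono_AE[OF remainder_eq(1)[OF \<open>0 < l\<close>]])
    show "integrable lborel (\<lambda>x. p / 2 * (weight l x * (incr l x)\<^sup>2))"
      using weight_incr_integrable[OF \<open>0 < l\<close>] by simp
    show "AE x in lborel.
        (u (l *\<^sub>R x) powr (p + 1) / (p + 1) - u (l *\<^sub>R x) powr (q + 1) / (q + 1))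
      - (u x powr (p + 1) / (p + 1) - u x powr (q + 1) / (q + 1))
      - (u x powr p - u x powr q) * (u (l *\<^sub>R x) - u x) \<le> p / 2 * (weight l x * (incr l x)\<^sup>2)"
      using u_pos dilation_pos[OF \<open>0 < l\<close>]
    proof eventually_elim
      case (elim x)
      then show ?case
        using reaction_taylor_le[OF p_gt_1 pq, of "u x" "u (l *\<^sub>R x)"]
        by (simp add: weight_def incr_def)
    qed
  qed
  finally show ?thesis by (simp add: \<mu>_def)
qed

text \<open>Inside the ball the weight is at most 1. Outside, it is bounded by a power of a
  potential that is small in L^(p+1) uniformly in \<open>l\<close>, so
  \<open>small_potential\<close> and the Sobolev inequality absorb that part into the
  energy.\<close>

lemma weight_tail:
  assumes "0 < \<epsilon>"
  obtains R where "0 < R" "\<And>l. 1 / 2 \<le> l \<Longrightarrow> l < 1 \<Longrightarrow>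
    (\<integral>x. weight l x * (incr l x)\<^sup>2 \<partial>lborel)
      \<le> (\<integral>x. indicator (ball 0 R) x * (incr l x)\<^sup>2 \<partial>lborel) + \<epsilon> * energy l"
proof -
  have dim: "real DIM(real ^ 'n) = real CARD('n)" by simp
  obtain C where "0 < C" and C: "\<And>(w :: real ^ 'n \<Rightarrow> real) e. w \<in> borel_measurable borel \<Longrightarrow>
      integrable lborel (\<lambda>x. \<bar>w x\<bar> powr (p + 1)) \<Longrightarrow> 0 \<le> e \<Longrightarrow>
      (\<integral>\<^sup>+x. gagliardo_density s w x \<partial>lborel) = ennreal e \<Longrightarrow>
      (\<integral>x. \<bar>w x\<bar> powr (p + 1) \<partial>lborel) powr (2 / (p + 1)) \<le> C * e"
    using fractional_sobolev[where 'a="real ^ 'n", of s "p + 1"] s p_eq unfolding dim by blast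
  have "0 < \<epsilon> / C" using assms \<open>0 < C\<close> by simp
  obtain \<delta> where "0 < \<delta>" and \<delta>: "\<And>(v :: real ^ 'n \<Rightarrow> real) w M. v \<in> borel_measurable M \<Longrightarrow> w \<in> borel_measurable M \<Longrightarrow>
      integrable M (\<lambda>x. \<bar>v x\<bar> powr (p + 1)) \<Longrightarrow> integrable M (\<lambda>x. \<bar>w x\<bar> powr (p + 1)) \<Longrightarrow>
      (\<integral>x. \<bar>v x\<bar> powr (p + 1) \<partial>M) \<le> \<delta> \<Longrightarrow>
      (\<integral>x. \<bar>v x\<bar> powr (p - 1) * (w x)\<^sup>2 \<partial>M) \<le> \<epsilon> / C * (\<integral>x. \<bar>w x\<bar> powr (p + 1) \<partial>M) powr (2 / (p + 1))"
    using small_potential[OF p_gt_1 \<open>0 < \<epsilon> / C\<close>, where 'a="real ^ 'n"] by blast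
  have u: "integrable lborel (\<lambda>x. \<bar>u x\<bar> powr (p + 1))"
    using u_Lp by (simp add: Lp_space_def)
  \<comment> \<open>The denominator pays for the tails of \<open>u\<close> and of its dilation, the
    latter with a Jacobian of at most 2^N.\<close>
  have "0 < \<delta> / (1 + 2 ^ CARD('n))"
    using \<open>0 < \<delta>\<close> by (simp add: add_pos_pos)
  then obtain R where "0 < R"
    and R: "(\<integral>x. indicator (- ball 0 R) x * \<bar>u x\<bar> powr (p + 1) \<partial>lborel) < \<delta> / (1 + 2 ^ CARD('n))"
    by (rule integral_outside_ball_small[OF u])
  define g where "g x = indicator (- ball 0 R) x * \<bar>u x\<bar> powr (p + 1)" for x
  have [measurable]: "g \<in> borel_measurable borel"
    unfolding g_def[abs_def] by measurable
  have g: "integrable lborel g"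
    unfolding g_def[abs_def] by (rule Bochner_Integration.integrable_bound[OF u]) (auto simp: indicator_def)
  have "(\<integral>x. weight l x * (incr l x)\<^sup>2 \<partial>lborel)
      \<le> (\<integral>x. indicator (ball 0 (2 * R)) x * (incr l x)\<^sup>2 \<partial>lborel) + \<epsilon> * energy l"
    if l: "1 / 2 \<le> l" "l < 1" for l
  proof -
    have "0 < l" using l by simp
    \<comment> \<open>The radius is doubled because, for l >= 1/2, |x| >= 2R puts both
      \<open>x\<close> and \<open>l *\<^sub>R x\<close> outside the ball of radius
      \<open>R\<close>.\<close>
    define v where "v x = indicator (- ball 0 (2 * R)) x * max \<bar>u x\<bar> \<bar>u (l *\<^sub>R x)\<bar>" for x
    have [measurable]: "v \<in> borel_measurable borel"
      unfolding v_def[abs_def] by measurable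
    have v_le: "\<bar>v x\<bar> powr (p + 1) \<le> g x + g (l *\<^sub>R x)" for x
    proof (cases "x \<in> ball 0 (2 * R)")
      case False
      then have "2 * R \<le> norm x" by simp
      then have "R \<le> norm x" "R \<le> l * norm x"
        using \<open>0 < R\<close> l mult_mono[of "1 / 2" l "2 * R" "norm x"] by auto
      then have "x \<notin> ball 0 R" "l *\<^sub>R x \<notin> ball 0 R"
        using \<open>0 < l\<close> by auto
      then show ?thesis
        using False by (auto simp: g_def v_def max_def)
    qed (auto simp: v_def g_def)
    have int_g: "integrable lborel (\<lambda>x. g x + g (l *\<^sub>R x))"
      using g integrable_dilation[OF g, of l] \<open>0 < l\<close> by simp
    have v: "integrable lborel (\<lambda>x. \<bar>v x\<bar> powr (p + 1))"
    proof (rule Bochner_Integration.integrable_bound[OF int_g])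
      show "AE x in lborel. norm (\<bar>v x\<bar> powr (p + 1)) \<le> norm (g x + g (l *\<^sub>R x))"
        using v_le by (intro AE_I2) (simp add: order_trans[OF _ abs_ge_self])
    qed measurable
    have "(\<integral>x. \<bar>v x\<bar> powr (p + 1) \<partial>lborel) \<le> (\<integral>x. g x + g (l *\<^sub>R x) \<partial>lborel)"
      by (intro integral_mono v int_g v_le)
    also have "\<dots> = integral\<^sup>L lborel g * (1 + 1 / l ^ CARD('n))"
      using g integrable_dilation[OF g, of l] \<open>0 < l\<close> by (simp add: integral_dilation distrib_left)
    also have "\<dots> \<le> integral\<^sup>L lborel g * (1 + 2 ^ CARD('n))"
    proof (intro mult_left_mono add_left_mono)
      have "(1 / 2) ^ CARD('n) \<le> l ^ CARD('n)"
        using l by (intro power_mono) auto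
      then show "1 / l ^ CARD('n) \<le> 2 ^ CARD('n)"
        using \<open>0 < l\<close> by (simp add: field_simps power_divide)
      show "0 \<le> integral\<^sup>L lborel g"
        by (intro integral_nonneg_AE) (auto simp: g_def)
    qed
    also have "\<dots> \<le> \<delta>"
      using R by (simp add: g_def[abs_def] pos_less_divide_eq add_pos_pos)
    finally have "(\<integral>x. \<bar>v x\<bar> powr (p - 1) * (incr l x)\<^sup>2 \<partial>lborel)
        \<le> \<epsilon> / C * (\<integral>x. \<bar>incr l x\<bar> powr (p + 1) \<partial>lborel) powr (2 / (p + 1))"
      using v incr_integrable[OF \<open>0 < l\<close>] by (intro \<delta>) auto
    also have "\<dots> \<le> \<epsilon> / C * (C * energy l)"
      using \<open>0 < \<epsilon> / C\<close> incr_integrable[OF \<open>0 < l\<close>] nn_integral_incr_density[OF \<open>0 < l\<close>] energy_nonneg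
      by (intro mult_left_mono C) auto
    finally have tail: "(\<integral>x. \<bar>v x\<bar> powr (p - 1) * (incr l x)\<^sup>2 \<partial>lborel) \<le> \<epsilon> * energy l"
      using \<open>0 < C\<close> by simp
    have int: "integrable lborel (\<lambda>x. indicator (ball 0 (2 * R)) x * (incr l x)\<^sup>2)"
      "integrable lborel (\<lambda>x. \<bar>v x\<bar> powr (p - 1) * (incr l x)\<^sup>2)"
      using v incr_integrable[OF \<open>0 < l\<close>] p_gt_1
      by (auto intro!: integrable_ball_power2[where r="p + 1"] integrable_powr_mult_power2)
    have "weight l x * (incr l x)\<^sup>2
        \<le> indicator (ball 0 (2 * R)) x * (incr l x)\<^sup>2 + \<bar>v x\<bar> powr (p - 1) * (incr l x)\<^sup>2" for x
    proof (cases "x \<in> ball 0 (2 * R)")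
      case True
      have "weight l x \<le> 1"
        unfolding weight_def using p_gt_1 by (intro powr_le1) auto
      then have "weight l x * (incr l x)\<^sup>2 \<le> 1 * (incr l x)\<^sup>2"
        by (intro mult_right_mono) auto
      then show ?thesis using True by (simp add: v_def)
    next
      case False
      then have "weight l x \<le> \<bar>v x\<bar> powr (p - 1)"
        unfolding weight_def v_def using p_gt_1 by (intro powr_mono2) auto
      then show ?thesis using False by (simp add: mult_right_mono)
    qed
    then have "(\<integral>x. weight l x * (incr l x)\<^sup>2 \<partial>lborel)
        \<le> (\<integral>x. indicator (ball 0 (2 * R)) x * (incr l x)\<^sup>2 + \<bar>v x\<bar> powr (p - 1) * (incr l x)\<^sup>2 \<partial>lborel)"
      using int weight_incr_integrable[OF \<open>0 < l\<close>] by (intro integral_mono) auto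
    with tail int show ?thesis by simp
  qed
  then show thesis
    using \<open>0 < R\<close> by (intro that[of "2 * R"]) auto
qed

text \<open>With w = \<open>incr l\<close>, the increment for \<open>l * l\<close> is the sum of w
  and its dilation, so 2w is this increment minus the dilation difference of w. The latter is
  controlled on the ball by \<open>nn_integral_dilation_diff_le\<close>.\<close>

lemma increment_second_difference:
  assumes "0 < R"
  obtains K where "0 < K" "\<And>l. 1 / 2 \<le> l \<Longrightarrow> l < 1 \<Longrightarrow>
    4 * (\<integral>x. indicator (ball 0 R) x * (incr l x)\<^sup>2 \<partial>lborel)
      \<le> 5 / 4 * (\<integral>x. indicator (ball 0 R) x * (incr (l * l) x)\<^sup>2 \<partial>lborel)
        + K * (1 - l) powr (2 * s) * energy l"
proof -
  define \<omega> where "\<omega> = unit_ball_vol (real DIM(real ^ 'n))"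
  have "0 < \<omega>" by (simp add: \<omega>_def)
  define K where "K = 2 * 2 powr (real DIM(real ^ 'n) + 2 * s) * (2 ^ DIM(real ^ 'n) + 1) * R powr (2 * s) / \<omega>"
  have "0 < K" using \<open>0 < \<omega>\<close> \<open>0 < R\<close> by (simp add: K_def add_pos_pos)
  have "4 * (\<integral>x. indicator (ball 0 R) x * (incr l x)\<^sup>2 \<partial>lborel)
      \<le> 5 / 4 * (\<integral>x. indicator (ball 0 R) x * (incr (l * l) x)\<^sup>2 \<partial>lborel)
        + 5 * K * (1 - l) powr (2 * s) * energy l" if l: "1 / 2 \<le> l" "l < 1" for l
  proof -
    have "0 < l" using l by simp
    then have "0 < l * l" by simp
    define d where "d x = incr l (l *\<^sub>R x) - incr l x" for x
    have [measurable]: "d \<in> borel_measurable borel"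
      unfolding d_def[abs_def] by measurable
    have "d \<in> Lp_space (p + 1)"
      unfolding d_def[abs_def] using incr_Lp[OF \<open>0 < l\<close>] \<open>0 < l\<close> p_gt_1
      by (intro Lp_space_diff Lp_space_dilation) auto
    then have "integrable lborel (\<lambda>x. \<bar>d x\<bar> powr (p + 1))" by (simp add: Lp_space_def)
    then have int: "integrable lborel (\<lambda>x. indicator (ball 0 R) x * (incr l x)\<^sup>2)"
      "integrable lborel (\<lambda>x. indicator (ball 0 R) x * (incr (l * l) x)\<^sup>2)"
      "integrable lborel (\<lambda>x. indicator (ball 0 R) x * (d x)\<^sup>2)"
      using incr_integrable[OF \<open>0 < l\<close>] incr_integrable[OF \<open>0 < l * l\<close>] p_gt_1
      by (auto intro!: integrable_ball_power2[where r="p + 1"])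
    have "ennreal (\<integral>x. indicator (ball 0 R) x * (d x)\<^sup>2 \<partial>lborel)
        = (\<integral>\<^sup>+x. ennreal (indicator (ball 0 R) x * (d x)\<^sup>2) \<partial>lborel)"
      using int(3) by (intro nn_integral_eq_integral[symmetric]) auto
    also have "\<dots> = (\<integral>\<^sup>+x. ennreal ((incr l (l *\<^sub>R x) - incr l x)\<^sup>2) * indicator (ball 0 R) x \<partial>lborel)"
      by (intro nn_integral_cong) (simp add: d_def indicator_def)
    also have "\<dots> \<le> ennreal (K * (1 - l) powr (2 * s)) * (\<integral>\<^sup>+x. gagliardo_density s (incr l) x \<partial>lborel)"
      unfolding K_def \<omega>_def using s l \<open>0 < R\<close> by (intro nn_integral_dilation_diff_le) auto
    also have "\<dots> = ennreal (K * (1 - l) powr (2 * s) * energy l)"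
      using \<open>0 < K\<close> energy_nonneg unfolding nn_integral_incr_density[OF \<open>0 < l\<close>]
      by (intro ennreal_mult[symmetric]) auto
    finally have d: "(\<integral>x. indicator (ball 0 R) x * (d x)\<^sup>2 \<partial>lborel) \<le> K * (1 - l) powr (2 * s) * energy l"
      using \<open>0 < K\<close> energy_nonneg by (subst (asm) ennreal_le_iff) auto
    have "4 * (incr l x)\<^sup>2 \<le> 5 / 4 * (incr (l * l) x)\<^sup>2 + 5 * (d x)\<^sup>2" for x
    proof -
      have "2 * incr l x = incr (l * l) x - d x"
        by (simp add: incr_def d_def)
      then have "4 * (incr l x)\<^sup>2 = (incr (l * l) x - d x)\<^sup>2"
        by (metis four_x_squared)
      \<comment> \<open>Young's inequality (a - d)^2 <= (1 + 1/4) a^2 + (1 + 4) d^2. Keeping the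
        first coefficient below 3/2 is what makes the final halving factor smaller than 1/2.\<close>
      also have "\<dots> \<le> 5 / 4 * (incr (l * l) x)\<^sup>2 + 5 * (d x)\<^sup>2"
        using zero_le_power2[of "incr (l * l) x + 4 * d x"] by (simp add: power2_eq_square algebra_simps)
      finally show ?thesis .
    qed
    then have "(\<integral>x. 4 * (indicator (ball 0 R) x * (incr l x)\<^sup>2) \<partial>lborel)
        \<le> (\<integral>x. 5 / 4 * (indicator (ball 0 R) x * (incr (l * l) x)\<^sup>2) + 5 * (indicator (ball 0 R) x * (d x)\<^sup>2) \<partial>lborel)"
      using int by (intro integral_mono) (auto simp: indicator_def)
    with d int show ?thesis by simp
  qed
  then show thesis
    using \<open>0 < K\<close> by (intro that[of "5 * K"]) auto
qed

lemma contradiction: False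
proof -
  define c where "c = frac_const CARD('n) s"
  have "0 < c" unfolding c_def using s by (intro frac_const_pos)
  \<comment> \<open>After multiplication by p / 2, this tail costs c / 8 times the energy, half of
    the coefficient c / 4 in the Pohozaev inequality.\<close>
  then have "0 < c / (4 * p)" using p_gt_1 by simp
  then obtain R where "0 < R" and R: "\<And>l. 1 / 2 \<le> l \<Longrightarrow> l < 1 \<Longrightarrow>
    (\<integral>x. weight l x * (incr l x)\<^sup>2 \<partial>lborel)
      \<le> (\<integral>x. indicator (ball 0 R) x * (incr l x)\<^sup>2 \<partial>lborel) + c / (4 * p) * energy l"
    by (rule weight_tail) blast
  obtain K where "0 < K" and K: "\<And>l. 1 / 2 \<le> l \<Longrightarrow> l < 1 \<Longrightarrow>
    4 * (\<integral>x. indicator (ball 0 R) x * (incr l x)\<^sup>2 \<partial>lborel)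
      \<le> 5 / 4 * (\<integral>x. indicator (ball 0 R) x * (incr (l * l) x)\<^sup>2 \<partial>lborel)
        + K * (1 - l) powr (2 * s) * energy l"
    using increment_second_difference[OF \<open>0 < R\<close>] by blast
  \<comment> \<open>With l = exp (-t), squaring \<open>l\<close> doubles \<open>t\<close>.\<close>
  define E where "E t = (\<integral>x. indicator (ball 0 R) x * (incr (exp (- t)) x)\<^sup>2 \<partial>lborel)" for t
  \<comment> \<open>The bound \<open>ln 2\<close> keeps l >= 1/2; the other one gives K * (1 -
    l)^(2s) <= c / (4p), since 1 - exp (-t) <= t.\<close>
  define t\<^sub>0 where "t\<^sub>0 = min (ln 2) ((c / (4 * p * K)) powr (1 / (2 * s)))"
  have "0 < t\<^sub>0" using \<open>0 < c\<close> \<open>0 < K\<close> p_gt_1 by (simp add: t\<^sub>0_def)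
  have l: "1 / 2 \<le> exp (- t)" "exp (- t) < 1" if "0 < t" "t \<le> t\<^sub>0" for t
  proof -
    have "exp (- ln 2) \<le> exp (- t)" using that by (simp add: t\<^sub>0_def)
    then show "1 / 2 \<le> exp (- t)" by (simp add: exp_minus)
  qed (use that in simp)
  \<comment> \<open>Both terms on the left are nonnegative: dropping the second bounds
    \<open>E t\<close> below by a multiple of \<open>t\<close>, dropping the first bounds the energy
    by a multiple of \<open>E t\<close>.\<close>
  have main: "gap * ((real CARD('n) - 2 * s) * t) + c / 8 * energy (exp (- t)) \<le> p / 2 * E t"
    if "0 < t" "t \<le> t\<^sub>0" for t
  proof -
    let ?l = "exp (- t)"
    have "(real CARD('n) - 2 * s) * t \<le> ?l powr (2 * s - real CARD('n)) - 1"
      using exp_ge_add_one_self[of "(real CARD('n) - 2 * s) * t"] by (simp add: powr_def algebra_simps)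
    then have "gap * ((real CARD('n) - 2 * s) * t) \<le> gap * (?l powr (2 * s - real CARD('n)) - 1)"
      using gap_pos by (intro mult_left_mono) auto
    moreover have "gap * (?l powr (2 * s - real CARD('n)) - 1) + c / 4 * energy ?l
        \<le> p / 2 * (\<integral>x. weight ?l x * (incr ?l x)\<^sup>2 \<partial>lborel)"
      unfolding c_def using that by (intro pohozaev_inequality) auto
    moreover have "p / 2 * (\<integral>x. weight ?l x * (incr ?l x)\<^sup>2 \<partial>lborel)
        \<le> p / 2 * (E t + c / (4 * p) * energy ?l)"
      unfolding E_def using p_gt_1 by (intro mult_left_mono R l that) auto
    moreover have "p / 2 * (E t + c / (4 * p) * energy ?l) = p / 2 * E t + c / 8 * energy ?l"
      using p_gt_1 by (simp add: distrib_left)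
    ultimately show ?thesis by simp
  qed
  show False
  proof (rule halving_contradiction[of "2 / p * (gap * (real CARD('n) - 2 * s))" t\<^sub>0 E])
    show "0 < 2 / p * (gap * (real CARD('n) - 2 * s))"
      using gap_pos s p_gt_1 by simp
    show "0 < t\<^sub>0" by fact
    fix t :: real
    assume "0 < t"
    {
      assume "t \<le> t\<^sub>0"
      have "0 \<le> c / 8 * energy (exp (- t))"
        using \<open>0 < c\<close> energy_nonneg by simp
      with main[OF \<open>0 < t\<close> \<open>t \<le> t\<^sub>0\<close>] have "gap * ((real CARD('n) - 2 * s) * t) \<le> p / 2 * E t"
        by linarith
      then show "2 / p * (gap * (real CARD('n) - 2 * s)) * t \<le> E t"
        using p_gt_1 by (simp add: field_simps)
    }
    assume "2 * t \<le> t\<^sub>0"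
    then have "t \<le> t\<^sub>0" using \<open>0 < t\<close> by simp
    let ?l = "exp (- t)"
    have "0 \<le> gap * ((real CARD('n) - 2 * s) * t)"
      using gap_pos s \<open>0 < t\<close> by simp
    with main[OF \<open>0 < t\<close> \<open>t \<le> t\<^sub>0\<close>] have "c / 8 * energy ?l \<le> p / 2 * E t"
      by linarith
    then have en: "energy ?l \<le> 4 * p / c * E t"
      using \<open>0 < c\<close> by (simp add: field_simps)
    have "(1 - ?l) powr (2 * s) \<le> ((c / (4 * p * K)) powr (1 / (2 * s))) powr (2 * s)"
      using l[OF \<open>0 < t\<close> \<open>t \<le> t\<^sub>0\<close>] \<open>t \<le> t\<^sub>0\<close> exp_ge_add_one_self[of "- t"] s
      by (intro powr_mono2) (auto simp: t\<^sub>0_def)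
    also have "\<dots> = c / (4 * p * K)"
      using s \<open>0 < c\<close> \<open>0 < K\<close> p_gt_1 by (simp add: powr_powr)
    finally have "K * (1 - ?l) powr (2 * s) \<le> K * (c / (4 * p * K))"
      using \<open>0 < K\<close> by (intro mult_left_mono) auto
    also have "\<dots> = c / (4 * p)"
      using \<open>0 < K\<close> by simp
    finally have "K * (1 - ?l) powr (2 * s) * energy ?l \<le> c / (4 * p) * (4 * p / c * E t)"
      using en energy_nonneg \<open>0 < c\<close> p_gt_1 by (intro mult_mono) auto
    also have "\<dots> = E t"
      using \<open>0 < c\<close> p_gt_1 by simp
    finally have "K * (1 - ?l) powr (2 * s) * energy ?l \<le> E t" .
    moreover have "4 * E t \<le> 5 / 4 * E (2 * t) + K * (1 - ?l) powr (2 * s) * energy ?l"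
    proof -
      have "?l * ?l = exp (- (2 * t))" by (simp flip: exp_add)
      then show ?thesis
        using K[OF l[OF \<open>0 < t\<close> \<open>t \<le> t\<^sub>0\<close>]] by (simp add: E_def)
    qed
    \<comment> \<open>The error term is at most \<open>E t\<close>, so 3 * E t <= 5/4 * E (2 *
      t).\<close>
    ultimately show "E t \<le> 5 / 12 * E (2 * t)" by linarith
  qed
qed

end

theorem theorem1p4:
  fixes s p q :: real
  assumes "0 < s" and "s < 1"
    and "real CARD('n) > 2 * s"
    and "p = crit_exp CARD('n) s - 1"
    and "q > p"
  shows "\<not> (\<exists>u :: real ^ 'n \<Rightarrow> real. weak_solution s p q u)"
proof
  assume "\<exists>u :: real ^ 'n \<Rightarrow> real. weak_solution s p q u"
  then obtain u :: "real ^ 'n \<Rightarrow> real" where "weak_solution s p q u" ..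
  with assms interpret supercritical_solution s p q u
    by unfold_locales auto
  show False by (rule contradiction)
qed

end
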